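(* Let $G=(V,E)$ be a loopless multigraph with $n=|V|$ and $m=|E|$, and let $k\in\mathbb{N}$. The algorithm described in the context (Algorithm 4) outputs every $k$-arc-connected orientation of $G$ exactly once, with delay $O(knm^2)$. If moreover $k\geq 2$, its amortized time is $O(m^2)$.
   Context: All graphs are loopless multigraphs; orientations may have parallel or anti-parallel arcs. For a digraph $D=(V,A)$ and $X\subseteq V$, $\delta^+_D(X)$ is the number of arcs $(x,y)$ with $x\in X$, $y\notin X$; $\delta^+_D(v)=\delta^+_D(\{v\})$. $D$ is $k$-arc-connected ($k$-connected) if $\delta^+_D(X)\ge k$ for every $\emptyset\ne X\subsetneq V$. For $B\subseteq A$, $D^B$ is the digraph obtained by reversing the arcs of $B$; $a^-$ is the reverse of arc $a$. $\lambda_D(u,v)$ is the maximum number of pairwise arc-disjoint directed $u$–$v$ paths. In a $k$-connected $D$, a pair $(u,v)$ of distinct vertices is flippable if $\lambda_D(u,v)>k$ (equivalently, reversing a directed $u$–$v$ path yields a $k$-connected digraph). For $\alpha:V\to\mathbb{N}$, an $\alpha$-orientation of $G$ is an orientation $D$ with $\delta^+_D(v)=\alpha(v)$ for all $v$. Procedure EnOPODS$(D,F)$ (with a fixed linear order on the edges of $G$; $D$ an orientation, $F$ a set of arcs of $D$): if $F$ does not contain all arcs of $D$, let $a=(u,v)$ be the arc of $D$ corresponding to the smallest edge not in $F$; call EnOPODS$(D,F\cup\{a\})$; then, if the digraph $D$ with the arcs of $F$ removed contains a directed path $P$ from $v$ to $u$, call EnOPODS$(D^{P\cup\{a\}},F\cup\{a^-\})$.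 Otherwise (all arcs fixed) output $D$. Procedures (with a fixed linear order on $V$): Reverse$^-(D,F,v)$: if there is $u\in V\setminus F$, $u\neq v$, with $(v,u)$ flippable in $D$, take a directed path $P$ from $v$ to $u$ in $D$, call Reverse$^-(D^P,F,v)$, then EnODS'$(D^P,F\cup\{v\})$. Reverse$^+(D,F,v)$: if there is $u\in V\setminus F$, $u\ne v$, with $(u,v)$ flippable in $D$, take a directed path $P$ from $u$ to $v$, call Reverse$^+(D^P,F,v)$, then EnODS'$(D^P,F\cup\{v\})$. EnODS'$(D,F)$: if $F\ne V$, let $v$ be the smallest vertex of $V\setminus F$ and call Reverse$^-(D,F,v)$, Reverse$^+(D,F,v)$, EnODS'$(D,F\cup\{v\})$; if $F=V$, call EnOPODS$(D,\emptyset)$. Algorithm 4: if $G$ has a $k$-connected orientation $D$ (found by a separate method running in $O(k^3n^3+kn^2m)$ time), fix a linear order on $V$ and call EnODS'$(D,\emptyset)$. Delay: the maximum time between two consecutive outputs, including before the first and after the last output. Amortized time: total running time divided by the number of outputs.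
   Formalization: Time bounds are stated for k ≥ 1 and n ≥ 2 (for k = 0 or m = 0 they would be 0); the delay bound excludes graphs with no k-connected orientation and kn > m, where the search for an initial orientation may exceed it; the amortized bound assumes an orientation exists. *)

theory Defs
  imports Complex_Main "Graph_Theory.Graph_Theory"
begin

section \<open>Multigraphs and orientations\<close>

text \<open>
  The vertices are the numbers below \<open>nv G\<close>; the edges are the positions of the list
  \<open>edge_list G\<close>, so that parallel edges are distinct. The end points of an edge are listed in
  an arbitrary order without meaning. The fixed linear orders on vertices and edges
  are the orders of the numbers; since the labelling is arbitrary, so are the orders.
\<close>

record mgraph =
  nv :: nat
  edge_list :: "(nat \<times> nat) list"

definition ne :: "mgraph \<Rightarrow> nat" where
  "ne G = length (edge_list G)"

definition loopless_multigraph :: "mgraph \<Rightarrow> bool" where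
  "loopless_multigraph G \<longleftrightarrow> (\<forall>(x, y) \<in> set (edge_list G). x < nv G \<and> y < nv G \<and> x \<noteq> y)"

text \<open>An orientation lists, edge by edge, the arc (tail, head) chosen for that edge.\<close>

type_synonym orientation = "(nat \<times> nat) list"

definition orientations :: "mgraph \<Rightarrow> orientation set" where
  "orientations G = {D. length D = ne G \<and>
     (\<forall>e < ne G. D ! e = edge_list G ! e \<or> D ! e = prod.swap (edge_list G ! e))}"

text \<open>The digraph with \<open>n\<close> vertices given by \<open>D\<close>, with the arcs in \<open>F\<close> removed.\<close>

definition digraph_of :: "nat \<Rightarrow> orientation \<Rightarrow> nat set \<Rightarrow> (nat, nat) pre_digraph" where
  "digraph_of n D F = \<lparr> verts = {..<n}, arcs = {..<length D} - F,
     tail = (\<lambda>e. fst (D ! e)), head = (\<lambda>e. snd (D ! e)) \<rparr>"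

definition reverse_arcs :: "orientation \<Rightarrow> nat set \<Rightarrow> orientation" where
  "reverse_arcs D B = map (\<lambda>e. if e \<in> B then prod.swap (D ! e) else D ! e) [0..<length D]"

definition cut_out :: "('v, 'e) pre_digraph \<Rightarrow> 'v set \<Rightarrow> nat" where
  "cut_out H X = card {e \<in> arcs H. tail H e \<in> X \<and> head H e \<notin> X}"

definition k_arc_connected :: "nat \<Rightarrow> ('v, 'e) pre_digraph \<Rightarrow> bool" where
  "k_arc_connected k H \<longleftrightarrow> (\<forall>X. X \<noteq> {} \<and> X \<subset> verts H \<longrightarrow> k \<le> cut_out H X)"

definition k_connected_orientations :: "mgraph \<Rightarrow> nat \<Rightarrow> orientation set" where
  "k_connected_orientations G k =
     {D \<in> orientations G. k_arc_connected k (digraph_of (nv G) D {})}"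

text \<open>Used for distinct \<open>u\<close>, \<open>v\<close> only, where directed paths are nonempty.\<close>

definition local_arc_connectivity :: "('v, 'e) pre_digraph \<Rightarrow> 'v \<Rightarrow> 'v \<Rightarrow> nat" where
  "local_arc_connectivity H u v =
     Max {card Ps | Ps. Ps \<subseteq> {p. pre_digraph.apath H u p v} \<and>
                        pairwise (\<lambda>p q. set p \<inter> set q = {}) Ps}"

definition flippable :: "nat \<Rightarrow> ('v, 'e) pre_digraph \<Rightarrow> 'v \<Rightarrow> 'v \<Rightarrow> bool" where
  "flippable k H u v \<longleftrightarrow>
     u \<in> verts H \<and> v \<in> verts H \<and> u \<noteq> v \<and> k < local_arc_connectivity H u v"


section \<open>Subroutines\<close>

text \<open>
  The enumeration procedures leave open which path and which flippable pair is taken. They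
  are therefore parametrised by subroutines that make these choices; each returns its
  result together with the number of elementary steps it took.

  \<^item> \<open>find_path D F s t\<close>: a directed \<open>s\<close>-\<open>t\<close> path of \<open>D\<close> without the arcs in \<open>F\<close>, if there is one.
  \<^item> \<open>find_out D F v\<close>: some \<open>u\<close> outside \<open>F\<close>, \<open>u \<noteq> v\<close>, with \<open>(v, u)\<close> flippable, if there is one.
  \<^item> \<open>find_in D F v\<close>: the same with \<open>(u, v)\<close> flippable.
\<close>

record subroutines =
  find_path :: "orientation \<Rightarrow> nat set \<Rightarrow> nat \<Rightarrow> nat \<Rightarrow> nat list option \<times> nat"
  find_out :: "orientation \<Rightarrow> nat set \<Rightarrow> nat \<Rightarrow> nat option \<times> nat"
  find_in :: "orientation \<Rightarrow> nat set \<Rightarrow> nat \<Rightarrow> nat option \<times> nat"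

definition finds :: "'a option \<Rightarrow> ('a \<Rightarrow> bool) \<Rightarrow> bool" where
  "finds r P \<longleftrightarrow> (case r of None \<Rightarrow> \<forall>x. \<not> P x | Some x \<Rightarrow> P x)"

definition correct_subroutines :: "mgraph \<Rightarrow> nat \<Rightarrow> subroutines \<Rightarrow> bool" where
  "correct_subroutines G k S \<longleftrightarrow>
     (\<forall>D \<in> orientations G. \<forall>F s t. s < nv G \<longrightarrow> t < nv G \<longrightarrow> s \<noteq> t \<longrightarrow>
        finds (fst (find_path S D F s t))
          (\<lambda>P. pre_digraph.apath (digraph_of (nv G) D F) s P t)) \<and>
     (\<forall>D \<in> k_connected_orientations G k. \<forall>F v. F \<subseteq> {..<nv G} \<longrightarrow> v < nv G \<longrightarrow> v \<notin> F \<longrightarrow>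
        finds (fst (find_out S D F v))
          (\<lambda>u. u \<in> {..<nv G} - F \<and> u \<noteq> v \<and> flippable k (digraph_of (nv G) D {}) v u) \<and>
        finds (fst (find_in S D F v))
          (\<lambda>u. u \<in> {..<nv G} - F \<and> u \<noteq> v \<and> flippable k (digraph_of (nv G) D {}) u v))"

text \<open>
  Linear time for a path search; for the search of a flippable pair, up to \<open>n\<close> pairs are tested
  by at most \<open>k + 1\<close> augmentations each.
\<close>

definition subroutines_within :: "nat \<Rightarrow> mgraph \<Rightarrow> nat \<Rightarrow> subroutines \<Rightarrow> bool" where
  "subroutines_within c G k S \<longleftrightarrow>
     (\<forall>D \<in> orientations G. \<forall>F s t. s < nv G \<longrightarrow> t < nv G \<longrightarrow> s \<noteq> t \<longrightarrow>
        snd (find_path S D F s t) \<le> c * (nv G + ne G)) \<and>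
     (\<forall>D \<in> k_connected_orientations G k. \<forall>F v. F \<subseteq> {..<nv G} \<longrightarrow> v < nv G \<longrightarrow> v \<notin> F \<longrightarrow>
        snd (find_out S D F v) \<le> c * ((k + 1) * nv G * (nv G + ne G)) \<and>
        snd (find_in S D F v) \<le> c * ((k + 1) * nv G * (nv G + ne G)))"


section \<open>Enumeration procedures\<close>

text \<open>
  A run of a procedure is recorded as a trace of elapsed steps and outputs.

  Every call is charged \<open>call_cost\<close> on entry, in addition to the steps of the subroutines, and
  one step on return. The entry charge pays for selecting the smallest unfixed edge or vertex,
  for building the arguments of the call (copies of the orientation and of the set \<open>F\<close>, with
  arcs reversed) and for writing an output.
\<close>

datatype event = Steps nat | Output orientation

type_synonym trace = "event list"

definition call_cost :: "nat \<Rightarrow> orientation \<Rightarrow> nat" where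
  "call_cost n D = n + length D + 1"

text \<open>
  A set \<open>F\<close> of arcs of the current orientation is given by the underlying edges; thus
  \<open>insert e F\<close> stands for \<open>F \<union> {a}\<close> as well as for \<open>F \<union> {a\<^sup>-}\<close>, depending on the orientation.
\<close>

inductive EnOPODS :: "nat \<Rightarrow> subroutines \<Rightarrow> orientation \<Rightarrow> nat set \<Rightarrow> trace \<Rightarrow> bool"
  for n :: nat and S :: subroutines where
  all_fixed:
    "{..<length D} \<subseteq> F \<Longrightarrow>
     EnOPODS n S D F [Steps (call_cost n D), Output D, Steps 1]"
| no_cycle:
    "\<not> {..<length D} \<subseteq> F \<Longrightarrow>
     e = Min ({..<length D} - F) \<Longrightarrow>
     D ! e = (u, v) \<Longrightarrow>
     EnOPODS n S D (insert e F) tr1 \<Longrightarrow>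
     find_path S D F v u = (None, t) \<Longrightarrow>
     EnOPODS n S D F (Steps (call_cost n D) # tr1 @ [Steps t, Steps 1])"
| cycle:
    "\<not> {..<length D} \<subseteq> F \<Longrightarrow>
     e = Min ({..<length D} - F) \<Longrightarrow>
     D ! e = (u, v) \<Longrightarrow>
     EnOPODS n S D (insert e F) tr1 \<Longrightarrow>
     find_path S D F v u = (Some P, t) \<Longrightarrow>
     EnOPODS n S (reverse_arcs D (insert e (set P))) (insert e F) tr2 \<Longrightarrow>
     EnOPODS n S D F (Steps (call_cost n D) # tr1 @ [Steps t] @ tr2 @ [Steps 1])"

inductive
  Reverse_minus :: "nat \<Rightarrow> subroutines \<Rightarrow> orientation \<Rightarrow> nat set \<Rightarrow> nat \<Rightarrow> trace \<Rightarrow> bool" and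
  Reverse_plus :: "nat \<Rightarrow> subroutines \<Rightarrow> orientation \<Rightarrow> nat set \<Rightarrow> nat \<Rightarrow> trace \<Rightarrow> bool" and
  EnODS' :: "nat \<Rightarrow> subroutines \<Rightarrow> orientation \<Rightarrow> nat set \<Rightarrow> trace \<Rightarrow> bool"
  for n :: nat and S :: subroutines where
  minus_stop:
    "find_out S D F v = (None, t) \<Longrightarrow>
     Reverse_minus n S D F v [Steps (call_cost n D), Steps t, Steps 1]"
| minus_flip:
    "find_out S D F v = (Some u, t) \<Longrightarrow>
     find_path S D {} v u = (Some P, t') \<Longrightarrow>
     Reverse_minus n S (reverse_arcs D (set P)) F v tr1 \<Longrightarrow>
     EnODS' n S (reverse_arcs D (set P)) (insert v F) tr2 \<Longrightarrow>
     Reverse_minus n S D F v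
       ([Steps (call_cost n D), Steps t, Steps t'] @ tr1 @ tr2 @ [Steps 1])"
| plus_stop:
    "find_in S D F v = (None, t) \<Longrightarrow>
     Reverse_plus n S D F v [Steps (call_cost n D), Steps t, Steps 1]"
| plus_flip:
    "find_in S D F v = (Some u, t) \<Longrightarrow>
     find_path S D {} u v = (Some P, t') \<Longrightarrow>
     Reverse_plus n S (reverse_arcs D (set P)) F v tr1 \<Longrightarrow>
     EnODS' n S (reverse_arcs D (set P)) (insert v F) tr2 \<Longrightarrow>
     Reverse_plus n S D F v
       ([Steps (call_cost n D), Steps t, Steps t'] @ tr1 @ tr2 @ [Steps 1])"
| ods_step:
    "\<not> {..<n} \<subseteq> F \<Longrightarrow>
     v = Min ({..<n} - F) \<Longrightarrow>
     Reverse_minus n S D F v tr1 \<Longrightarrow>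
     Reverse_plus n S D F v tr2 \<Longrightarrow>
     EnODS' n S D (insert v F) tr3 \<Longrightarrow>
     EnODS' n S D F (Steps (call_cost n D) # tr1 @ tr2 @ tr3 @ [Steps 1])"
| ods_all_fixed:
    "{..<n} \<subseteq> F \<Longrightarrow>
     EnOPODS n S D {} tr \<Longrightarrow>
     EnODS' n S D F (Steps (call_cost n D) # tr @ [Steps 1])"

text \<open>
  The argument \<open>(r, t)\<close> of \<open>algorithm4\<close> is what the separate method for finding an initial
  orientation returns: its result and its number of steps.
\<close>

inductive algorithm4 ::
  "mgraph \<Rightarrow> subroutines \<Rightarrow> orientation option \<times> nat \<Rightarrow> trace \<Rightarrow> bool"
  for G :: mgraph and S :: subroutines where
  infeasible: "algorithm4 G S (None, t) [Steps t]"
| feasible: "EnODS' (nv G) S D {} tr \<Longrightarrow> algorithm4 G S (Some D, t) (Steps t # tr)"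

definition correct_start :: "mgraph \<Rightarrow> nat \<Rightarrow> orientation option \<times> nat \<Rightarrow> bool" where
  "correct_start G k I \<longleftrightarrow> finds (fst I) (\<lambda>D. D \<in> k_connected_orientations G k)"

definition start_within :: "nat \<Rightarrow> mgraph \<Rightarrow> nat \<Rightarrow> orientation option \<times> nat \<Rightarrow> bool" where
  "start_within c G k I \<longleftrightarrow> snd I \<le> c * (k ^ 3 * nv G ^ 3 + k * nv G ^ 2 * ne G)"


section \<open>Outputs, delay and amortized time of a trace\<close>

fun outputs :: "trace \<Rightarrow> orientation list" where
  "outputs [] = []"
| "outputs (Steps t # tr) = outputs tr"
| "outputs (Output D # tr) = D # outputs tr"

fun total_time :: "trace \<Rightarrow> nat" where
  "total_time [] = 0"
| "total_time (Steps t # tr) = t + total_time tr"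
| "total_time (Output D # tr) = total_time tr"

text \<open>
  The times before the first output, between consecutive outputs and after the last one;
  the first argument accumulates the time since the last output.
\<close>

fun gaps :: "nat \<Rightarrow> trace \<Rightarrow> nat list" where
  "gaps a [] = [a]"
| "gaps a (Steps t # tr) = gaps (a + t) tr"
| "gaps a (Output D # tr) = a # gaps 0 tr"

definition delay :: "trace \<Rightarrow> nat" where
  "delay tr = Max (set (gaps 0 tr))"

definition amortized_time :: "trace \<Rightarrow> real" where
  "amortized_time tr = real (total_time tr) / real (length (outputs tr))"


section \<open>Standard subroutines\<close>

text \<open>
  Paths are found by depth-first search on adjacency lists, flippability of a pair is tested by
  \<open>k + 1\<close> augmentations, where augmenting along a path means reversing it. Indexing and updating
  a list at a position (used as an array), testing membership in a set (a Boolean array) and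
  adding an element in front of a list count as one step.
\<close>

fun build_adj :: "orientation \<Rightarrow> nat set \<Rightarrow> nat list \<Rightarrow> nat list list \<Rightarrow> nat list list \<times> nat" where
  "build_adj D F [] adj = (adj, 1)"
| "build_adj D F (e # es) adj =
     (let adj' = (if e \<in> F then adj else adj[fst (D ! e) := e # adj ! fst (D ! e)]);
          (r, t) = build_adj D F es adj'
      in (r, t + 1))"

lemma unmark_decreases:
  assumes "x < length un" "un ! x"
  shows "length (filter id (un[x := False])) < length (filter id un)"
  using assms
proof (induction un arbitrary: x)
  case (Cons b un)
  then show ?case by (cases x) auto
qed simp

text \<open>
  The stack holds vertices, each with the reverse of a path leading to it;
  \<open>un\<close> marks the unvisited vertices.
\<close>

function dfs :: "orientation \<Rightarrow> nat list list \<Rightarrow> nat \<Rightarrow> bool list \<Rightarrow> (nat \<times> nat list) list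
    \<Rightarrow> nat list option \<times> nat" where
  "dfs D adj goal un [] = (None, 1)"
| "dfs D adj goal un ((x, p) # stk) =
     (if x = goal then (Some (rev p), 1 + length p)
      else if x < length un \<and> un ! x then
        (let (r, t) = dfs D adj goal (un[x := False])
                        (map (\<lambda>e. (snd (D ! e), e # p)) (adj ! x) @ stk)
         in (r, t + 1 + length (adj ! x)))
      else (let (r, t) = dfs D adj goal un stk in (r, t + 1)))"
  by pat_completeness auto
termination
  by (relation "measures [\<lambda>(D, adj, goal, un, stk). length (filter id un),
                          \<lambda>(D, adj, goal, un, stk). length stk]")
     (auto simp: unmark_decreases)

definition std_path ::
  "nat \<Rightarrow> orientation \<Rightarrow> nat set \<Rightarrow> nat \<Rightarrow> nat \<Rightarrow> nat list option \<times> nat" where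
  "std_path n D F s t =
     (let (adj, t1) = build_adj D F [0..<length D] (replicate n []);
          (r, t2) = dfs D adj t (replicate n True) [(s, [])]
      in (r, 2 * n + t1 + t2))"

fun std_augment :: "nat \<Rightarrow> nat \<Rightarrow> orientation \<Rightarrow> nat \<Rightarrow> nat \<Rightarrow> bool \<times> nat" where
  "std_augment 0 n D u v = (True, 1)"
| "std_augment (Suc j) n D u v =
     (case std_path n D {} u v of
        (None, t) \<Rightarrow> (False, t + 1)
      | (Some P, t) \<Rightarrow>
          (let (b, t') = std_augment j n (reverse_arcs D (set P)) u v
           in (b, t + length D + t' + 1)))"

fun first_such :: "(nat \<Rightarrow> bool \<times> nat) \<Rightarrow> nat list \<Rightarrow> nat option \<times> nat" where
  "first_such test [] = (None, 1)"
| "first_such test (u # us) =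
     (let (b, t) = test u in
      if b then (Some u, t + 1)
      else (let (r, t') = first_such test us in (r, t + t' + 1)))"

definition std_find ::
  "nat \<Rightarrow> (nat \<Rightarrow> bool \<times> nat) \<Rightarrow> nat set \<Rightarrow> nat \<Rightarrow> nat option \<times> nat" where
  "std_find n test F v =
     (let (r, t) = first_such test (filter (\<lambda>u. u \<notin> F \<and> u \<noteq> v) [0..<n]) in (r, n + t))"

definition std_subroutines :: "mgraph \<Rightarrow> nat \<Rightarrow> subroutines" where
  "std_subroutines G k =
     \<lparr> find_path = std_path (nv G),
       find_out = (\<lambda>D F v. std_find (nv G) (\<lambda>u. std_augment (k + 1) (nv G) D v u) F v),
       find_in = (\<lambda>D F v. std_find (nv G) (\<lambda>u. std_augment (k + 1) (nv G) D u v) F v) \<rparr>"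

end

theory Submission
  imports Defs
begin

text \<open>
  The number of arcs leaving \<open>X\<close> is the sum of the outdegrees over \<open>X\<close> minus the number of edges inside
  \<open>X\<close>, so \<open>k\<close>-connectedness depends on the outdegrees only, and two orientations with the same
  outdegrees differ by arc-disjoint directed cycles. Hence \<open>EnOPODS\<close> enumerates an outdegree class by
  branching on the direction of an edge. By Menger's theorem a pair that is not flippable is
  separated by a tight set, and by uncrossing tight sets a flippable pair exists whenever some
  \<open>k\<close>-connected orientation with the prescribed outdegrees on \<open>F\<close> has another outdegree at \<open>v\<close>. So
  every branch of \<open>EnODS'\<close> leads to an output.

  Between two outputs, a vertex \<open>v\<close> is responsible for at most \<open>O(deg v)\<close> flippability tests of cost
  \<open>O(k n m)\<close> each, and the degrees sum up to \<open>2 m\<close>; this gives the delay. For the amortized time, each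
  outdegree vector costs \<open>O(n)\<close> tests, and for \<open>k \<ge> 2\<close> its class has at least
  \<open>m - n + 1 \<ge> m / 2 \<ge> k n / 2\<close> members, as a strongly connected digraph has that many directed cycles.
\<close>

section \<open>Orientations and cuts\<close>

text \<open>Menger's theorem itself comes out of path reversals: reversing an s-t path lowers every
  cut that separates s from t by exactly one, so j reversals in a row are possible if these cuts are
  at least j, and the arcs in which the result differs from the start contain j arc-disjoint s-t
  paths. What shapes the time analysis is that a \<open>Reverse\<close> call may cost a full search
  for a flippable pair and output nothing. For the delay, two budgets are kept: the time pending at
  the end of a call of \<open>EnODS'\<close>, which does not depend on the time pending at its start
  because such a call always outputs something, and the time needed to reach the next output. For
  the amortized time, unproductive searches are charged to the call of \<open>EnODS'\<close> that
  follows them. The chain m - n + 1 \<ge> m / 2 \<ge> k n / 2 rests on k n \<le> m, which holds for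
  n \<ge> 2 because every outdegree is at least k; for k \<ge> 2 it gives 2 n \<le> m. The class
  size then cancels the factor k n in the cost of a search.\<close>

lemma length_reverse_arcs [simp]: "length (reverse_arcs D B) = length D"
  by (simp add: reverse_arcs_def)

lemma nth_reverse_arcs [simp]:
  "e < length D \<Longrightarrow> reverse_arcs D B ! e = (if e \<in> B then prod.swap (D ! e) else D ! e)"
  by (simp add: reverse_arcs_def)

lemma digraph_of_simps [simp]:
  "verts (digraph_of n D F) = {..<n}" "arcs (digraph_of n D F) = {..<length D} - F"
  "tail (digraph_of n D F) e = fst (D ! e)" "head (digraph_of n D F) e = snd (D ! e)"
  by (simp_all add: digraph_of_def)

section \<open>Outdegrees and their change under reversal of arcs\<close>

definition outdeg :: "orientation \<Rightarrow> nat \<Rightarrow> nat" where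
  "outdeg D v = card {e. e < length D \<and> fst (D ! e) = v}"

abbreviation cut_size :: "mgraph \<Rightarrow> orientation \<Rightarrow> nat set \<Rightarrow> nat" where
  "cut_size G D X \<equiv> cut_out (digraph_of (nv G) D {}) X"

lemma cut_out_digraph_of:
  "cut_out (digraph_of n D {}) X = card {e. e < length D \<and> fst (D ! e) \<in> X \<and> snd (D ! e) \<notin> X}"
  by (simp add: cut_out_def)

lemma sum_outdeg:
  assumes "finite X"
  shows "(\<Sum>v\<in>X. outdeg D v) = card {e. e < length D \<and> fst (D ! e) \<in> X}"
proof -
  have "card (\<Union>v\<in>X. {e. e < length D \<and> fst (D ! e) = v}) = (\<Sum>v\<in>X. outdeg D v)"
    unfolding outdeg_def using assms by (intro card_UN_disjoint) auto
  moreover have "(\<Union>v\<in>X. {e. e < length D \<and> fst (D ! e) = v}) = {e. e < length D \<and> fst (D ! e) \<in> X}"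
    by auto
  ultimately show ?thesis by simp
qed

lemma outdeg_conv_sum: "int (outdeg D v) = (\<Sum>e<length D. of_bool (fst (D ! e) = v))"
proof -
  have "{e. e < length D \<and> fst (D ! e) = v} = {..<length D} \<inter> {e. fst (D ! e) = v}" by auto
  then show ?thesis by (simp add: outdeg_def sum_of_bool_eq)
qed

text \<open>A reversed arc takes one unit of outdegree from its tail and gives one to its head. Over
  the integers these contributions can cancel along a walk.\<close>

lemma outdeg_reverse_arcs:
  assumes "B \<subseteq> {..<length D}"
  shows "int (outdeg (reverse_arcs D B) v) =
    int (outdeg D v) + (\<Sum>e\<in>B. of_bool (snd (D ! e) = v) - of_bool (fst (D ! e) = v))"
proof -
  have "int (outdeg (reverse_arcs D B) v) - int (outdeg D v) =
      (\<Sum>e<length D. of_bool (fst (reverse_arcs D B ! e) = v) - of_bool (fst (D ! e) = v))"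
    by (simp add: outdeg_conv_sum sum_subtractf)
  also have "\<dots> = (\<Sum>e<length D. if e \<in> B then of_bool (snd (D ! e) = v) - of_bool (fst (D ! e) = v) else 0)"
    by (intro sum.cong) auto
  also have "\<dots> = (\<Sum>e\<in>B. of_bool (snd (D ! e) = v) - of_bool (fst (D ! e) = v))"
    using assms by (simp add: sum.If_cases Int_absorb1)
  finally show ?thesis by simp
qed

text \<open>Telescoping: each visit to an inner vertex contributes once as a head and once as a
  tail.\<close>

lemma cas_balance:
  assumes "pre_digraph.cas (digraph_of n D F) s p t"
  shows "(\<Sum>e\<leftarrow>p. of_bool (snd (D ! e) = v) - of_bool (fst (D ! e) = v)) =
    (of_bool (t = v) - of_bool (s = v) :: int)"
  using assms by (induction p arbitrary: s) (auto simp: pre_digraph.cas.simps)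

text \<open>A path depends only on its own arcs. This carries paths over between different sets of
  removed arcs and between successive orientations.\<close>

lemma apath_cong:
  assumes "pre_digraph.apath (digraph_of n D F) s p t"
    and "set p \<subseteq> {..<length D'} - F'" and "\<And>e. e \<in> set p \<Longrightarrow> D' ! e = D ! e"
  shows "pre_digraph.apath (digraph_of n D' F') s p t"
proof -
  have "pre_digraph.cas (digraph_of n D F) s p t = pre_digraph.cas (digraph_of n D' F') s p t"
    using assms(3) by (induction p arbitrary: s) (auto simp: pre_digraph.cas.simps)
  moreover have "pre_digraph.awalk_verts (digraph_of n D F) s p = pre_digraph.awalk_verts (digraph_of n D' F') s p"
    using assms(3) by (induction p arbitrary: s) (auto simp: pre_digraph.awalk_verts.simps)
  ultimately show ?thesis
    using assms(1,2) by (auto simp: pre_digraph.apath_def pre_digraph.awalk_def)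
qed

lemma cas_crosses:
  assumes "pre_digraph.cas H s p t" "s \<in> X" "t \<notin> X"
  shows "\<exists>e\<in>set p. tail H e \<in> X \<and> head H e \<notin> X"
  using assms
proof (induction p arbitrary: s)
  case (Cons e p)
  then show ?case by (cases "head H e \<in> X") (auto simp: pre_digraph.cas.simps)
qed (auto simp: pre_digraph.cas.simps)

locale multigraph =
  fixes G :: mgraph
  assumes loopless: "loopless_multigraph G"
begin

lemma length_orientation: "D \<in> orientations G \<Longrightarrow> length D = ne G"
  by (simp add: orientations_def)

lemma orientation_arc:
  assumes "D \<in> orientations G" "e < ne G"
  shows "fst (D ! e) < nv G" "snd (D ! e) < nv G" "fst (D ! e) \<noteq> snd (D ! e)"
proof -
  have "edge_list G ! e \<in> set (edge_list G)" using assms by (simp add: ne_def)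
  then have "fst (edge_list G ! e) < nv G \<and> snd (edge_list G ! e) < nv G \<and>
      fst (edge_list G ! e) \<noteq> snd (edge_list G ! e)"
    using loopless unfolding loopless_multigraph_def by (metis (mono_tags, lifting) case_prod_beta)
  moreover have "D ! e = edge_list G ! e \<or> D ! e = prod.swap (edge_list G ! e)"
    using assms by (simp add: orientations_def)
  ultimately show "fst (D ! e) < nv G" "snd (D ! e) < nv G" "fst (D ! e) \<noteq> snd (D ! e)" by auto
qed

lemma orientation_flip:
  assumes "D \<in> orientations G" "D' \<in> orientations G" "e < ne G" "D' ! e \<noteq> D ! e"
  shows "D' ! e = prod.swap (D ! e)"
  using assms unfolding orientations_def by (metis (mono_tags, lifting) mem_Collect_eq swap_swap)

lemma orientation_eqI:
  assumes "D \<in> orientations G" "D' \<in> orientations G" "\<And>e. e < ne G \<Longrightarrow> D ! e = D' ! e"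
  shows "D = D'"
  using assms by (intro nth_equalityI) (auto simp: length_orientation)

lemma reverse_orientation: "D \<in> orientations G \<Longrightarrow> reverse_arcs D B \<in> orientations G"
  by (auto simp: orientations_def)

lemma finite_orientations: "finite (orientations G)"
proof -
  have "orientations G \<subseteq> {xs. set xs \<subseteq> {..<nv G} \<times> {..<nv G} \<and> length xs = ne G}"
  proof safe
    fix D a b assume "D \<in> orientations G" "(a, b) \<in> set D"
    then show "a < nv G" "b < nv G"
      using orientation_arc[of D] by (metis fst_conv snd_conv in_set_conv_nth length_orientation)+
  qed (simp add: length_orientation)
  then show ?thesis
    by (rule finite_subset) (intro finite_lists_length_eq, simp)
qed

lemma fin_digraph_orientation:
  assumes "D \<in> orientations G"
  shows "fin_digraph (digraph_of (nv G) D F)"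
  by unfold_locales (use assms in \<open>auto simp: length_orientation orientation_arc\<close>)

lemma apath_arcs:
  assumes "D \<in> orientations G" "pre_digraph.apath (digraph_of (nv G) D F) s P t"
  shows "set P \<subseteq> {..<ne G} - F" "distinct P" "pre_digraph.cas (digraph_of (nv G) D F) s P t"
proof -
  interpret fin_digraph "digraph_of (nv G) D F" by (rule fin_digraph_orientation[OF assms(1)])
  have *: "awalk s P t" "distinct (awalk_verts s P)" using assms(2) by (auto simp: apath_def)
  show "set P \<subseteq> {..<ne G} - F" "cas s P t"
    using *(1) length_orientation[OF assms(1)] by (auto simp: awalk_def)
  show "distinct P" using * distinct_verts_imp_distinct by blast
qed

lemma outdeg_reverse_path:
  assumes "D \<in> orientations G" "pre_digraph.apath (digraph_of (nv G) D F) s P t"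
  shows "int (outdeg (reverse_arcs D (set P)) v) = int (outdeg D v) + of_bool (t = v) - of_bool (s = v)"
proof -
  note P = apath_arcs[OF assms]
  have "(\<Sum>e\<in>set P. of_bool (snd (D ! e) = v) - of_bool (fst (D ! e) = v)) =
      (of_bool (t = v) - of_bool (s = v) :: int)"
    using cas_balance[OF P(3), of v] P(2) by (simp add: sum_list_distinct_conv_sum_set)
  then show ?thesis
    using outdeg_reverse_arcs[of "set P" D v] P(1) length_orientation[OF assms(1)]
    by (metis (no_types, lifting) Diff_subset add_diff_eq subset_trans)
qed

text \<open>\<open>P\<close> ends in \<open>u\<close> and visits it only once, so it cannot contain
  \<open>e\<close>, whose tail is \<open>u\<close>. Hence \<open>e\<close> closes \<open>P\<close>
  to a cycle, and the balances of the two cancel at every vertex.\<close>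

lemma outdeg_reverse_cycle:
  assumes D: "D \<in> orientations G" and e: "e < ne G" "D ! e = (u, v)"
    and P: "pre_digraph.apath (digraph_of (nv G) D F) v P u"
  shows "e \<notin> set P" "outdeg (reverse_arcs D (insert e (set P))) = outdeg D"
proof -
  have "u \<noteq> v" using orientation_arc[OF D e(1)] e(2) by simp
  interpret fin_digraph "digraph_of (nv G) D F" by (rule fin_digraph_orientation[OF D])
  note P' = apath_arcs[OF D P]
  show ne: "e \<notin> set P"
  proof
    assume "e \<in> set P"
    have "distinct (awalk_verts v P)" "awlast v P = u" using P by (auto simp: apath_def)
    moreover have "awalk_verts v P = map (\<lambda>e. fst (D ! e)) P @ [snd (D ! last P)]"
      using \<open>e \<in> set P\<close> by (auto simp: awalk_verts_conv)
    moreover have "u \<in> set (map (\<lambda>e. fst (D ! e)) P)"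
      using \<open>e \<in> set P\<close> e(2) by force
    ultimately show False by auto
  qed
  have "(\<Sum>e\<in>set P. of_bool (snd (D ! e) = w) - of_bool (fst (D ! e) = w)) =
      (of_bool (u = w) - of_bool (v = w) :: int)" for w
    using cas_balance[OF P'(3), of w] P'(2) by (simp add: sum_list_distinct_conv_sum_set)
  moreover have "int (outdeg (reverse_arcs D (insert e (set P))) w) = int (outdeg D w) + 
     (\<Sum>e\<in>insert e (set P). of_bool (snd (D ! e) = w) - of_bool (fst (D ! e) = w))" for w
    using P'(1) e(1) by (intro outdeg_reverse_arcs) (auto simp: length_orientation[OF D])
  ultimately have "int (outdeg (reverse_arcs D (insert e (set P))) w) = int (outdeg D w)" for w
    using ne e(2) by (simp)
  then show "outdeg (reverse_arcs D (insert e (set P))) = outdeg D" by (simp add: fun_eq_iff)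
qed

section \<open>Cuts as functions of the outdegrees\<close>

lemma sum_outdeg_conv_cut:
  assumes D: "D \<in> orientations G" and "finite X"
  shows "(\<Sum>v\<in>X. outdeg D v) =
    cut_size G D X + card {e. e < ne G \<and> fst (edge_list G ! e) \<in> X \<and> snd (edge_list G ! e) \<in> X}"
proof -
  have "D ! e = edge_list G ! e \<or> D ! e = prod.swap (edge_list G ! e)" if "e < ne G" for e
    using D that by (simp add: orientations_def)
  then have *: "fst (edge_list G ! e) \<in> X \<and> snd (edge_list G ! e) \<in> X \<longleftrightarrow>
      fst (D ! e) \<in> X \<and> snd (D ! e) \<in> X" if "e < ne G" for e
    using that by fastforce
  have "{e. e < ne G \<and> fst (edge_list G ! e) \<in> X \<and> snd (edge_list G ! e) \<in> X} =
     {e. e < ne G \<and> fst (D ! e) \<in> X \<and> snd (D ! e) \<in> X}"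
    using * by blast
  moreover have "card {e. e < ne G \<and> fst (D ! e) \<in> X} =
      card {e. e < ne G \<and> fst (D ! e) \<in> X \<and> snd (D ! e) \<notin> X} +
      card {e. e < ne G \<and> fst (D ! e) \<in> X \<and> snd (D ! e) \<in> X}"
    by (subst card_Un_disjoint[symmetric]) (auto intro: arg_cong[where f = card])
  ultimately show ?thesis
    using sum_outdeg[OF \<open>finite X\<close>, of D] by (simp add: length_orientation[OF D] cut_out_digraph_of)
qed

lemma cut_diff:
  assumes "D \<in> orientations G" "D' \<in> orientations G" "finite X"
  shows "int (cut_size G D' X) - int (cut_size G D X) = (\<Sum>v\<in>X. int (outdeg D' v) - int (outdeg D v))"
  using sum_outdeg_conv_cut[OF assms(1,3)] sum_outdeg_conv_cut[OF assms(2,3)]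
  by (simp add: sum_subtractf flip: of_nat_sum)

text \<open>The path may cross the boundary of \<open>X\<close> repeatedly and in both directions.
  Going through the outdegrees avoids counting the crossings, since only the two ends change their
  outdegree.\<close>

lemma cut_reverse_path:
  assumes "D \<in> orientations G" "pre_digraph.apath (digraph_of (nv G) D F) s P t" "finite X" "s \<in> X" "t \<notin> X"
  shows "int (cut_size G (reverse_arcs D (set P)) X) = int (cut_size G D X) - 1"
proof -
  have "int (cut_size G (reverse_arcs D (set P)) X) - int (cut_size G D X) =
      (\<Sum>v\<in>X. of_bool (t = v) - of_bool (s = v))"
    by (simp add: cut_diff[OF assms(1) reverse_orientation[OF assms(1)] assms(3)]
        outdeg_reverse_path[OF assms(1,2)])
  also have "\<dots> = - 1"
    using assms(3-5) by (simp add: sum_subtractf of_bool_def)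
  finally show ?thesis by simp
qed

text \<open>Apply the premise to the set of vertices reachable from \<open>s\<close>. In this form
  the existence of a path becomes a question about sets without leaving arcs, that is, about
  cuts.\<close>

lemma apath_existsI:
  assumes D: "D \<in> orientations G" and s: "s < nv G"
    and closed: "\<And>X. X \<subseteq> {..<nv G} \<Longrightarrow> s \<in> X \<Longrightarrow>
      (\<And>e. e < ne G \<Longrightarrow> e \<notin> F \<Longrightarrow> fst (D ! e) \<in> X \<Longrightarrow> snd (D ! e) \<in> X) \<Longrightarrow> t \<in> X"
  shows "\<exists>P. pre_digraph.apath (digraph_of (nv G) D F) s P t"
proof -
  interpret fin_digraph "digraph_of (nv G) D F" by (rule fin_digraph_orientation[OF D])
  let ?H = "digraph_of (nv G) D F"
  have "t \<in> {x. reachable ?H s x}"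
  proof (rule closed)
    show "{x. reachable ?H s x} \<subseteq> {..<nv G}" using reachable_in_verts by auto
    show "s \<in> {x. reachable ?H s x}" using s by simp
    fix e assume "e < ne G" "e \<notin> F" and r: "fst (D ! e) \<in> {x. reachable ?H s x}"
    then have "e \<in> arcs ?H" by (simp add: length_orientation[OF D])
    then have "(fst (D ! e), snd (D ! e)) \<in> arcs_ends ?H" by (force simp: arcs_ends_conv)
    then show "snd (D ! e) \<in> {x. reachable ?H s x}"
      using r by (auto intro: reachable_adj_trans)
  qed
  then show ?thesis using reachable_apath by simp
qed

text \<open>If no differing arc leaves \<open>X\<close>, all arcs leaving \<open>X\<close> in
  \<open>D\<close> survive, and the new ones are the differing arcs that entered \<open>X\<close>.
  So the cut can only grow, which is played off against the balance of outdegrees.\<close>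

lemma cut_closed_diff:
  assumes D: "D \<in> orientations G" "D' \<in> orientations G"
    and closed: "\<And>e. e < ne G \<Longrightarrow> D' ! e \<noteq> D ! e \<Longrightarrow> fst (D ! e) \<in> X \<Longrightarrow> snd (D ! e) \<in> X"
  shows "cut_size G D' X = cut_size G D X +
    card {e. e < ne G \<and> D' ! e \<noteq> D ! e \<and> fst (D ! e) \<notin> X \<and> snd (D ! e) \<in> X}"
proof -
  have "{e. e < ne G \<and> fst (D' ! e) \<in> X \<and> snd (D' ! e) \<notin> X} =
      {e. e < ne G \<and> fst (D ! e) \<in> X \<and> snd (D ! e) \<notin> X} \<union>
      {e. e < ne G \<and> D' ! e \<noteq> D ! e \<and> fst (D ! e) \<notin> X \<and> snd (D ! e) \<in> X}" (is "?A = ?B \<union> ?C")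
  proof (rule set_eqI)
    fix e
    show "e \<in> ?A \<longleftrightarrow> e \<in> ?B \<union> ?C"
    proof (cases "e < ne G \<and> D' ! e \<noteq> D ! e")
      case True
      then show ?thesis
        using closed[of e] orientation_flip[OF D, of e] by auto
    next
      case False
      then show ?thesis by auto
    qed
  qed
  moreover have "card (?B \<union> ?C) = card ?B + card ?C"
    by (intro card_Un_disjoint) auto
  ultimately show ?thesis
    by (simp add: cut_out_digraph_of length_orientation D)
qed

end

section \<open>Flippable pairs\<close>

text \<open>Holds arc by arc, once cuts are written as sums of indicators.\<close>

lemma cut_out_submodular:
  "cut_out (digraph_of n D {}) (X \<inter> Y) + cut_out (digraph_of n D {}) (X \<union> Y) \<le>
    cut_out (digraph_of n D {}) X + cut_out (digraph_of n D {}) Y"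
proof -
  have "cut_out (digraph_of n D {}) X = (\<Sum>e<length D. of_bool (fst (D ! e) \<in> X \<and> snd (D ! e) \<notin> X))" for X
  proof -
    have "{e. e < length D \<and> fst (D ! e) \<in> X \<and> snd (D ! e) \<notin> X} =
        {..<length D} \<inter> {e. fst (D ! e) \<in> X \<and> snd (D ! e) \<notin> X}" by auto
    then show ?thesis by (simp add: cut_out_digraph_of sum_of_bool_eq)
  qed
  then show ?thesis
    by (simp add: sum.distrib[symmetric] del: sum_of_bool_eq) (intro sum_mono, auto)
qed

text \<open>The inclusion-maximal members are pairwise disjoint, as the union of two that meet is
  again a member, so the sum over \<open>\<Union>T\<close> splits into their nonpositive sums.
  \<open>T\<close> will consist of tight sets or of their complements.\<close>

lemma sum_Union_nonpos:
  fixes f :: "'a \<Rightarrow> int"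
  assumes fin: "finite V" "\<And>X. X \<in> T \<Longrightarrow> X \<subseteq> V"
    and Un: "\<And>X Y. X \<in> T \<Longrightarrow> Y \<in> T \<Longrightarrow> X \<inter> Y \<noteq> {} \<Longrightarrow> X \<union> Y \<in> T"
    and nonpos: "\<And>X. X \<in> T \<Longrightarrow> sum f X \<le> 0"
  shows "sum f (\<Union>T) \<le> 0"
proof -
  define M where "M = {X \<in> T. \<forall>Y\<in>T. X \<subseteq> Y \<longrightarrow> X = Y}"
  have finT: "finite T" using fin by (meson PowI finite_Pow_iff finite_subset subsetI)
  have above: "\<exists>Y\<in>M. X \<subseteq> Y" if "X \<in> T" for X
    using finite_has_maximal2[OF finT that] unfolding M_def by auto
  have "\<Union>T = \<Union>M"
  proof
    show "\<Union>T \<subseteq> \<Union>M" using above by fast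
    show "\<Union>M \<subseteq> \<Union>T" by (auto simp: M_def)
  qed
  moreover have "sum f (\<Union>M) = (\<Sum>X\<in>M. sum f X)"
  proof (rule sum.Union_disjoint[unfolded comp_def])
    show "\<forall>A\<in>M. finite A" by (auto simp: M_def intro: finite_subset[OF fin(2) fin(1)])
    show "\<forall>X\<in>M. \<forall>Y\<in>M. X \<noteq> Y \<longrightarrow> X \<inter> Y = {}"
    proof (intro ballI impI, rule ccontr)
      fix X Y assume X: "X \<in> M" and Y: "Y \<in> M" and "X \<noteq> Y" "X \<inter> Y \<noteq> {}"
      then have "X \<union> Y \<in> T" using Un by (simp add: M_def)
      then have "X = X \<union> Y" "Y = X \<union> Y" using X Y unfolding M_def by fast+
      then show False using \<open>X \<noteq> Y\<close> by simp
    qed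
  qed
  moreover have "(\<Sum>X\<in>M. sum f X) \<le> 0"
  proof (rule sum_nonpos)
    show "sum f X \<le> 0" if "X \<in> M" for X using nonpos that by (simp add: M_def)
  qed
  ultimately show ?thesis by simp
qed

section \<open>Menger's theorem by reversing paths\<close>

context multigraph begin

text \<open>Augmentation as for flows: the reoriented digraph acts as the residual digraph, and each
  round spends one unit of every separating cut. Only the resulting outdegrees are kept; the paths
  found here need not be arc-disjoint in \<open>D\<close>.\<close>

lemma shifted_orientation_exists:
  assumes "D \<in> orientations G" "s < nv G" "s \<noteq> t"
    and "\<And>X. X \<subseteq> {..<nv G} \<Longrightarrow> s \<in> X \<Longrightarrow> t \<notin> X \<Longrightarrow> j \<le> cut_size G D X"
  shows "\<exists>D'\<in>orientations G. \<forall>v. int (outdeg D' v) = int (outdeg D v) + int j * (of_bool (t = v) - of_bool (s = v))"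
  using assms(1,4)
proof (induction j arbitrary: D)
  case 0
  then show ?case by auto
next
  case (Suc j)
  have "\<exists>P. pre_digraph.apath (digraph_of (nv G) D {}) s P t"
  proof (rule apath_existsI[OF Suc.prems(1) assms(2)], rule ccontr)
    fix X assume X: "X \<subseteq> {..<nv G}" "s \<in> X" "t \<notin> X"
      and closed: "\<And>e. e < ne G \<Longrightarrow> e \<notin> {} \<Longrightarrow> fst (D ! e) \<in> X \<Longrightarrow> snd (D ! e) \<in> X"
    have "{e. e < length D \<and> fst (D ! e) \<in> X \<and> snd (D ! e) \<notin> X} = {}"
      using closed length_orientation[OF Suc.prems(1)] by auto
    then have "cut_size G D X = 0" unfolding cut_out_digraph_of by (simp only: card.empty)
    then show False using Suc.prems(2)[OF X] by simp
  qed
  then obtain P where P: "pre_digraph.apath (digraph_of (nv G) D {}) s P t" by blast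
  have "j \<le> cut_size G (reverse_arcs D (set P)) X" if "X \<subseteq> {..<nv G}" "s \<in> X" "t \<notin> X" for X
    using cut_reverse_path[OF Suc.prems(1) P _ that(2,3)] Suc.prems(2)[OF that] finite_subset[OF that(1)]
    by simp
  then obtain D' where D': "D' \<in> orientations G" 
    "\<And>v. int (outdeg D' v) = int (outdeg (reverse_arcs D (set P)) v) + int j * (of_bool (t = v) - of_bool (s = v))"
    using Suc.IH[OF reverse_orientation[OF Suc.prems(1), of "set P"]] by blast
  then show ?case
    by (intro bexI[of _ D']) (simp_all add: outdeg_reverse_path[OF Suc.prems(1) P] algebra_simps)
qed

text \<open>Flow decomposition: the differing arcs form a flow of value \<open>j\<close>. A set
  containing \<open>s\<close> but not \<open>t\<close> that no differing arc leaves would have a cut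
  that does not shrink, although its outdegrees drop by \<open>j\<close> in total. Reversing the
  path found makes its arcs agree with \<open>D'\<close>; the remaining paths use only differing
  arcs and therefore avoid it.\<close>

lemma disjoint_paths_exist:
  assumes "D \<in> orientations G" and D': "D' \<in> orientations G" and st: "s < nv G" "s \<noteq> t"
    and "\<And>v. int (outdeg D' v) = int (outdeg D v) + int j * (of_bool (t = v) - of_bool (s = v))"
  shows "\<exists>Ps. finite Ps \<and> card Ps = j \<and> pairwise (\<lambda>p q. set p \<inter> set q = {}) Ps \<and>
    (\<forall>p\<in>Ps. pre_digraph.apath (digraph_of (nv G) D {}) s p t \<and> (\<forall>e\<in>set p. D' ! e \<noteq> D ! e))"
  using assms(1,5)
proof (induction j arbitrary: D)
  case 0
  then show ?case by (intro exI[of _ "{}"]) auto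
next
  case (Suc j)
  note D = Suc.prems(1)
  let ?F = "{e. D' ! e = D ! e}"
  have "\<exists>P. pre_digraph.apath (digraph_of (nv G) D ?F) s P t"
  proof (rule apath_existsI[OF D st(1)], rule ccontr)
    fix X assume X: "X \<subseteq> {..<nv G}" "s \<in> X" "t \<notin> X"
      and closed: "\<And>e. e < ne G \<Longrightarrow> e \<notin> ?F \<Longrightarrow> fst (D ! e) \<in> X \<Longrightarrow> snd (D ! e) \<in> X"
    have fin: "finite X" using X(1) finite_subset by blast
    have "cut_size G D X \<le> cut_size G D' X" using cut_closed_diff[OF D D', of X] closed by auto
    moreover have "int (cut_size G D' X) - int (cut_size G D X) = - int (Suc j)"
      using X(2,3) fin
      by (simp add: cut_diff[OF D D' fin] Suc.prems(2) sum_subtractf of_bool_def flip: sum_distrib_left)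
    ultimately show False by simp
  qed
  then obtain P where P: "pre_digraph.apath (digraph_of (nv G) D ?F) s P t" by blast
  note P' = apath_arcs[OF D P]
  let ?D1 = "reverse_arcs D (set P)"
  have nth_D1: "?D1 ! e = (if e \<in> set P then D' ! e else D ! e)" if "e < ne G" for e
  proof (cases "e \<in> set P")
    case True
    then have "D' ! e \<noteq> D ! e" using P'(1) by auto
    then show ?thesis using orientation_flip[OF D D' that] length_orientation[OF D] that True by simp
  qed (use length_orientation[OF D] that in simp)
  have "int (outdeg D' v) = int (outdeg ?D1 v) + int j * (of_bool (t = v) - of_bool (s = v))" for v
    using Suc.prems(2)[of v] by (simp add: outdeg_reverse_path[OF D P] algebra_simps)
  then obtain Ps where Ps: "finite Ps" "card Ps = j" "pairwise (\<lambda>p q. set p \<inter> set q = {}) Ps"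
    "\<And>p. p \<in> Ps \<Longrightarrow> pre_digraph.apath (digraph_of (nv G) ?D1 {}) s p t"
    "\<And>p e. p \<in> Ps \<Longrightarrow> e \<in> set p \<Longrightarrow> D' ! e \<noteq> ?D1 ! e"
    using Suc.IH[OF reverse_orientation[OF D, of "set P"]] by blast
  have arcs: "set p \<subseteq> {..<ne G}" if "p \<in> Ps" for p
    using apath_arcs(1)[OF reverse_orientation[OF D] Ps(4)[OF that]] by simp
  have disj: "set P \<inter> set p = {}" if "p \<in> Ps" for p
    using Ps(5)[OF that] arcs[OF that] nth_D1 by fastforce
  have in_D: "pre_digraph.apath (digraph_of (nv G) D {}) s p t" if "p \<in> Ps" for p
  proof (rule apath_cong[OF Ps(4)[OF that]])
    show "D ! e = ?D1 ! e" if "e \<in> set p" for e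
    proof -
      have "e < ne G" "e \<notin> set P" using arcs[OF \<open>p \<in> Ps\<close>] disj[OF \<open>p \<in> Ps\<close>] that by auto
      then show ?thesis using length_orientation[OF D] by simp
    qed
  qed (use arcs[OF that] length_orientation[OF D] in auto)
  have P_D: "pre_digraph.apath (digraph_of (nv G) D {}) s P t"
    by (rule apath_cong[OF P]) (use P'(1) length_orientation[OF D] in auto)
  \<comment> \<open>Disjointness of arc sets separates \<open>P\<close> from the members of
    \<open>Ps\<close> only because \<open>P\<close> has an arc.\<close>
  have "P \<noteq> []" using P'(3) st(2) by (auto simp: pre_digraph.cas.simps)
  then have "P \<notin> Ps" using disj by force
  show ?case
  proof (intro exI[of _ "insert P Ps"] conjI ballI)
    show "card (insert P Ps) = Suc j" using Ps(1,2) \<open>P \<notin> Ps\<close> by simp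
    show "pairwise (\<lambda>p q. set p \<inter> set q = {}) (insert P Ps)"
      using Ps(3) disj by (auto simp: pairwise_insert)
    fix p e assume p: "p \<in> insert P Ps" and e: "e \<in> set p"
    show "D' ! e \<noteq> D ! e"
    proof (cases "p = P")
      case True
      then show ?thesis using P'(1) e by auto
    next
      case False
      then have "p \<in> Ps" using p by simp
      then have "e < ne G" "e \<notin> set P" "D' ! e \<noteq> ?D1 ! e" using arcs disj Ps(5) e by auto
      then show ?thesis using nth_D1 by simp
    qed
  qed (use Ps(1) in_D P_D in auto)
qed

text \<open>Menger's theorem for a single pair. From arc-disjoint paths an arc leaving
  \<open>X\<close> can be picked injectively; conversely, \<open>k + 1\<close> units of outdegree
  are shifted from \<open>s\<close> to \<open>t\<close> and the difference is decomposed into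
  paths.\<close>

lemma flippable_iff:
  assumes D: "D \<in> orientations G"
  shows "flippable k (digraph_of (nv G) D {}) s t \<longleftrightarrow>
    s < nv G \<and> t < nv G \<and> s \<noteq> t \<and> (\<forall>X \<subseteq> {..<nv G}. s \<in> X \<longrightarrow> t \<notin> X \<longrightarrow> k < cut_size G D X)"
proof (cases "s < nv G \<and> t < nv G \<and> s \<noteq> t")
  case True
  let ?H = "digraph_of (nv G) D {}"
  interpret fin_digraph ?H by (rule fin_digraph_orientation[OF D])
  let ?M = "{card Ps | Ps. Ps \<subseteq> {p. apath s p t} \<and> pairwise (\<lambda>p q. set p \<inter> set q = {}) Ps}"
  have "?M \<subseteq> card ` Pow {p. apath s p t}" by blast
  then have finM: "finite ?M" using apaths_finite[of s t] finite_subset by blast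
  \<comment> \<open>The empty family keeps \<open>?M\<close> nonempty, so that \<open>Max\<close> is
    attained.\<close>
  have "card {} \<in> ?M" by (rule CollectI, rule exI[of _ "{}"]) auto
  then have "Max ?M \<in> ?M" using finM by (intro Max_in) auto
  have "k < Max ?M \<longleftrightarrow> (\<forall>X \<subseteq> {..<nv G}. s \<in> X \<longrightarrow> t \<notin> X \<longrightarrow> k < cut_size G D X)"
  proof (intro iffI allI impI)
    fix X assume "k < Max ?M" and X: "X \<subseteq> {..<nv G}" "s \<in> X" "t \<notin> X"
    obtain Ps where Ps: "card Ps = Max ?M" "Ps \<subseteq> {p. apath s p t}"
      "pairwise (\<lambda>p q. set p \<inter> set q = {}) Ps"
      using \<open>Max ?M \<in> ?M\<close> by (auto simp del: Max_in)
    have "\<forall>p\<in>Ps. \<exists>e\<in>set p. fst (D ! e) \<in> X \<and> snd (D ! e) \<notin> X"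
    proof
      fix p assume "p \<in> Ps"
      then have "cas s p t" using Ps(2) by (auto simp: apath_def awalk_def)
      from cas_crosses[OF this X(2,3)] show "\<exists>e\<in>set p. fst (D ! e) \<in> X \<and> snd (D ! e) \<notin> X" by simp
    qed
    then obtain f where f: "\<And>p. p \<in> Ps \<Longrightarrow> f p \<in> set p \<and> fst (D ! f p) \<in> X \<and> snd (D ! f p) \<notin> X"
      by metis
    have "inj_on f Ps"
      using f Ps(3) unfolding inj_on_def pairwise_def by (metis IntI empty_iff)
    moreover have "f ` Ps \<subseteq> {e. e < length D \<and> fst (D ! e) \<in> X \<and> snd (D ! e) \<notin> X}"
    proof
      fix e assume "e \<in> f ` Ps"
      then obtain p where p: "p \<in> Ps" "e = f p" by auto
      then have "set p \<subseteq> {..<ne G} - {}" using apath_arcs(1)[OF D] Ps(2) by blast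
      then show "e \<in> {e. e < length D \<and> fst (D ! e) \<in> X \<and> snd (D ! e) \<notin> X}"
        using f[OF p(1)] p(2) length_orientation[OF D] by auto
    qed
    ultimately have "card Ps \<le> cut_size G D X"
      unfolding cut_out_digraph_of by (intro card_inj_on_le) auto
    then show "k < cut_size G D X" using \<open>k < Max ?M\<close> Ps(1) by simp
  next
    assume *: "\<forall>X \<subseteq> {..<nv G}. s \<in> X \<longrightarrow> t \<notin> X \<longrightarrow> k < cut_size G D X"
    then have "\<And>X. X \<subseteq> {..<nv G} \<Longrightarrow> s \<in> X \<Longrightarrow> t \<notin> X \<Longrightarrow> Suc k \<le> cut_size G D X" by (simp add: Suc_leI)
    then obtain D' where D': "D' \<in> orientations G"
      "\<And>v. int (outdeg D' v) = int (outdeg D v) + int (Suc k) * (of_bool (t = v) - of_bool (s = v))"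
      using shifted_orientation_exists[OF D, of s t "Suc k"] True by blast
    obtain Ps where "card Ps = Suc k" "pairwise (\<lambda>p q. set p \<inter> set q = {}) Ps" "\<forall>p\<in>Ps. apath s p t"
      using disjoint_paths_exist[OF D D'(1) _ _ D'(2)] True by blast
    then have "Suc k \<in> ?M" by (intro CollectI exI[of _ Ps]) auto
    then have "Suc k \<le> Max ?M" by (rule Max_ge[OF finM])
    then show "k < Max ?M" by simp
  qed
  then show ?thesis using True by (simp add: flippable_def local_arc_connectivity_def)
qed (auto simp: flippable_def)

section \<open>Flips that preserve connectedness, and existence of flippable pairs\<close>

lemma k_connected_cut:
  assumes "D \<in> k_connected_orientations G k" "X \<noteq> {}" "X \<subset> {..<nv G}"
  shows "k \<le> cut_size G D X"
  using assms by (simp add: k_connected_orientations_def k_arc_connected_def)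

lemma k_connected_orientation: "D \<in> k_connected_orientations G k \<Longrightarrow> D \<in> orientations G"
  by (simp add: k_connected_orientations_def)

lemma k_connected_outdeg_cong:
  assumes "D \<in> k_connected_orientations G k" "D' \<in> orientations G" "outdeg D' = outdeg D"
  shows "D' \<in> k_connected_orientations G k"
proof -
  have "cut_size G D' X = cut_size G D X" if "X \<subset> {..<nv G}" for X
    using cut_diff[OF k_connected_orientation[OF assms(1)] assms(2), of X] assms(3) that
      finite_subset[of X "{..<nv G}"] by auto
  then show ?thesis
    using assms by (simp add: k_connected_orientations_def k_arc_connected_def)
qed

text \<open>Only sets containing \<open>s\<close> but not \<open>t\<close> lose a unit of their cut,
  and flippability gives these cuts a unit of slack.\<close>

lemma k_connected_flip:
  assumes D: "D \<in> k_connected_orientations G k" and fl: "flippable k (digraph_of (nv G) D {}) s t"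
    and P: "pre_digraph.apath (digraph_of (nv G) D F) s P t"
  shows "reverse_arcs D (set P) \<in> k_connected_orientations G k"
proof -
  note D' = k_connected_orientation[OF D]
  have "k \<le> cut_size G (reverse_arcs D (set P)) X" if X: "X \<noteq> {}" "X \<subset> {..<nv G}" for X
  proof -
    have fin: "finite X" using X finite_subset by blast
    have "int (cut_size G (reverse_arcs D (set P)) X) - int (cut_size G D X) = of_bool (t \<in> X) - of_bool (s \<in> X)"
      using fin by (simp add: cut_diff[OF D' reverse_orientation[OF D']]
          outdeg_reverse_path[OF D' P] sum_subtractf of_bool_def)
    moreover have "k \<le> cut_size G D X" by (rule k_connected_cut[OF D X])
    moreover have "k < cut_size G D X" if "s \<in> X" "t \<notin> X"
      using fl that X unfolding flippable_iff[OF D'] by auto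
    ultimately show ?thesis by (auto simp: of_bool_def split: if_splits)
  qed
  then show ?thesis
    using reverse_orientation[OF D'] by (simp add: k_connected_orientations_def k_arc_connected_def)
qed

lemma sum_outdeg_orientation:
  assumes "D \<in> orientations G"
  shows "(\<Sum>v<nv G. outdeg D v) = ne G"
proof -
  have "{e. e < length D \<and> fst (D ! e) \<in> {..<nv G}} = {..<ne G}"
    using orientation_arc(1)[OF assms] length_orientation[OF assms] by auto
  then show ?thesis using sum_outdeg[of "{..<nv G}" D] by simp
qed

text \<open>
  If no flippable pair starts in \<open>v\<close>, the vertices outside \<open>F\<close> and different from \<open>v\<close> are covered by
  complements of tight sets; by uncrossing, the maximal ones among these are disjoint, and the
  total outdegree on each of them does not increase from \<open>D\<close> to \<open>D'\<close>.
\<close>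

lemma flippable_out_exists:
  assumes D: "D \<in> k_connected_orientations G k" and D': "D' \<in> k_connected_orientations G k"
    and v: "v < nv G" "outdeg D' v < outdeg D v"
    and F: "\<And>u. u \<in> F \<Longrightarrow> u \<noteq> v \<Longrightarrow> outdeg D' u = outdeg D u"
  shows "\<exists>u \<in> {..<nv G} - F. u \<noteq> v \<and> flippable k (digraph_of (nv G) D {}) v u"
proof (rule ccontr)
  assume none: "\<not> ?thesis"
  note O = k_connected_orientation[OF D] k_connected_orientation[OF D']
  define f where "f u = int (outdeg D' u) - int (outdeg D u)" for u
  \<comment> \<open>The sets obstructing \<open>(v, u)\<close> contain \<open>v\<close>. Passing to
    complements turns their intersections into unions of sets that avoid \<open>v\<close>.\<close>
  define T where "T = {Z. Z \<subseteq> {..<nv G} - {v} \<and> Z \<noteq> {} \<and> cut_size G D ({..<nv G} - Z) = k}"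
  have tot: "(\<Sum>u<nv G. f u) = 0"
    using sum_outdeg_orientation[OF O(1)] sum_outdeg_orientation[OF O(2)]
    by (simp add: f_def sum_subtractf flip: of_nat_sum)
  have "sum f (\<Union>T) \<le> 0"
  proof (rule sum_Union_nonpos[of "{..<nv G}"])
    fix X Y assume X: "X \<in> T" and Y: "Y \<in> T" and XY: "X \<inter> Y \<noteq> {}"
    let ?X = "{..<nv G} - X" and ?Y = "{..<nv G} - Y"
    \<comment> \<open>The tight sets meet in \<open>v\<close>, and
      \<open>X \<inter> Y \<noteq> {}\<close> keeps their union proper. So both lower bounds apply,
      and submodularity makes the intersection tight.\<close>
    have "k \<le> cut_size G D (?X \<inter> ?Y)" "k \<le> cut_size G D (?X \<union> ?Y)"
      using X Y XY v(1) unfolding T_def by (intro k_connected_cut[OF D]; blast)+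
    moreover have "cut_size G D (?X \<inter> ?Y) + cut_size G D (?X \<union> ?Y) \<le> k + k"
      using cut_out_submodular[of "nv G" D ?X ?Y] X Y by (simp add: T_def)
    ultimately have "cut_size G D (?X \<inter> ?Y) = k" by linarith
    moreover have "?X \<inter> ?Y = {..<nv G} - (X \<union> Y)" by blast
    ultimately show "X \<union> Y \<in> T" using X Y by (auto simp: T_def)
  next
    fix Z assume Z: "Z \<in> T"
    have "k \<le> cut_size G D' ({..<nv G} - Z)"
      using Z v(1) unfolding T_def by (intro k_connected_cut[OF D']) auto
    moreover have "int (cut_size G D' ({..<nv G} - Z)) - int (cut_size G D ({..<nv G} - Z)) = sum f ({..<nv G} - Z)"
      unfolding f_def by (rule cut_diff[OF O]) simp
    moreover have "sum f ({..<nv G} - Z) = sum f {..<nv G} - sum f Z"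
      using Z by (intro sum_diff) (auto simp: T_def)
    ultimately show "sum f Z \<le> 0" using Z tot by (auto simp: T_def)
  qed (auto simp: T_def)
  have cover: "u \<in> \<Union>T" if u: "u < nv G" "u \<notin> F" "u \<noteq> v" for u
  proof -
    have "\<not> flippable k (digraph_of (nv G) D {}) v u" using none u by blast
    then obtain X where X: "X \<subseteq> {..<nv G}" "v \<in> X" "u \<notin> X" "\<not> k < cut_size G D X"
      using u v(1) unfolding flippable_iff[OF O(1)] by auto
    then have "k \<le> cut_size G D X" using u by (intro k_connected_cut[OF D]) auto
    moreover have "{..<nv G} - ({..<nv G} - X) = X" using X by blast
    ultimately have in_T: "{..<nv G} - X \<in> T" using X u by (auto simp: T_def)
    moreover have "u \<in> {..<nv G} - X" using X u by auto
    ultimately show ?thesis by blast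
  qed
  have UT: "\<Union>T \<subseteq> {..<nv G} - {v}" by (auto simp: T_def)
  have "sum f {..<nv G} = f v + sum f ({..<nv G} - {v})"
    using v(1) by (simp add: sum.remove)
  \<comment> \<open>Vertices other than \<open>v\<close> that \<open>T\<close> does not cover lie in
    \<open>F\<close>, where the outdegrees agree. The total of \<open>f\<close> is then at most
    \<open>f v\<close>, which is negative.\<close>
  also have "sum f ({..<nv G} - {v}) = sum f (\<Union>T)"
  proof (rule sum.mono_neutral_right[OF _ UT])
    show "\<forall>i\<in>{..<nv G} - {v} - \<Union> T. f i = 0"
      using cover F unfolding f_def by (metis DiffE insertI1 lessThan_iff diff_self)
  qed simp
  finally show False using tot \<open>sum f (\<Union>T) \<le> 0\<close> v(2) by (simp add: f_def)
qed

text \<open>Mirror image of \<open>flippable_out_exists\<close>: a set obstructing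
  \<open>(u, v)\<close> contains \<open>u\<close> and avoids \<open>v\<close>, so tight sets are
  used directly instead of their complements, and the sign of \<open>f\<close> is reversed.\<close>

lemma flippable_in_exists:
  assumes D: "D \<in> k_connected_orientations G k" and D': "D' \<in> k_connected_orientations G k"
    and v: "v < nv G" "outdeg D v < outdeg D' v"
    and F: "\<And>u. u \<in> F \<Longrightarrow> u \<noteq> v \<Longrightarrow> outdeg D' u = outdeg D u"
  shows "\<exists>u \<in> {..<nv G} - F. u \<noteq> v \<and> flippable k (digraph_of (nv G) D {}) u v"
proof (rule ccontr)
  assume none: "\<not> ?thesis"
  note O = k_connected_orientation[OF D] k_connected_orientation[OF D']
  define f where "f u = int (outdeg D u) - int (outdeg D' u)" for u
  define T where "T = {Z. Z \<subseteq> {..<nv G} - {v} \<and> Z \<noteq> {} \<and> cut_size G D Z = k}"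
  have tot: "(\<Sum>u<nv G. f u) = 0"
    using sum_outdeg_orientation[OF O(1)] sum_outdeg_orientation[OF O(2)]
    by (simp add: f_def sum_subtractf flip: of_nat_sum)
  have "sum f (\<Union>T) \<le> 0"
  proof (rule sum_Union_nonpos[of "{..<nv G}"])
    fix X Y assume X: "X \<in> T" and Y: "Y \<in> T" and XY: "X \<inter> Y \<noteq> {}"
    have "k \<le> cut_size G D (X \<inter> Y)" "k \<le> cut_size G D (X \<union> Y)"
      using X Y XY v(1) unfolding T_def by (intro k_connected_cut[OF D]; blast)+
    moreover have "cut_size G D (X \<inter> Y) + cut_size G D (X \<union> Y) \<le> k + k"
      using cut_out_submodular[of "nv G" D X Y] X Y by (simp add: T_def)
    ultimately have "cut_size G D (X \<union> Y) = k" by linarith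
    then show "X \<union> Y \<in> T" using X Y by (auto simp: T_def)
  next
    fix Z assume Z: "Z \<in> T"
    have "k \<le> cut_size G D' Z"
      using Z v(1) unfolding T_def by (intro k_connected_cut[OF D']) auto
    moreover have "int (cut_size G D Z) - int (cut_size G D' Z) = sum f Z"
      unfolding f_def using Z finite_subset[of Z "{..<nv G}"]
      by (intro cut_diff[OF O(2,1)]) (auto simp: T_def)
    ultimately show "sum f Z \<le> 0" using Z by (auto simp: T_def)
  qed (auto simp: T_def)
  have cover: "u \<in> \<Union>T" if u: "u < nv G" "u \<notin> F" "u \<noteq> v" for u
  proof -
    have "\<not> flippable k (digraph_of (nv G) D {}) u v" using none u by blast
    then obtain X where X: "X \<subseteq> {..<nv G}" "u \<in> X" "v \<notin> X" "\<not> k < cut_size G D X"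
      using u v(1) unfolding flippable_iff[OF O(1)] by auto
    then have "k \<le> cut_size G D X" using v by (intro k_connected_cut[OF D]) auto
    then have "X \<in> T" using X by (auto simp: T_def)
    then show ?thesis using X by auto
  qed
  have UT: "\<Union>T \<subseteq> {..<nv G} - {v}" by (auto simp: T_def)
  have "sum f {..<nv G} = f v + sum f ({..<nv G} - {v})"
    using v(1) by (simp add: sum.remove)
  also have "sum f ({..<nv G} - {v}) = sum f (\<Union>T)"
  proof (rule sum.mono_neutral_right[OF _ UT])
    show "\<forall>i\<in>{..<nv G} - {v} - \<Union> T. f i = 0"
      using cover F unfolding f_def by (metis DiffE insertI1 lessThan_iff diff_self)
  qed simp
  finally show False using tot \<open>sum f (\<Union>T) \<le> 0\<close> v(2) by (simp add: f_def)
qed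

end

section \<open>Correctness of the enumeration\<close>

lemma outputs_append [simp]: "outputs (tr @ tr') = outputs tr @ outputs tr'"
  by (induction tr rule: outputs.induct) auto

lemma finds_None: "finds None P \<longleftrightarrow> (\<forall>x. \<not> P x)"
  and finds_Some: "finds (Some x) P \<longleftrightarrow> P x"
  by (simp_all add: finds_def)

lemma Min_unfixed:
  fixes m :: nat
  assumes "\<not> {..<m} \<subseteq> F" and "e = Min ({..<m} - F)"
  shows "e < m" "e \<notin> F"
proof -
  have "{..<m} - F \<noteq> {}" using assms(1) by blast
  then have "e \<in> {..<m} - F" unfolding assms(2) by (intro Min_in) simp_all
  then show "e < m" "e \<notin> F" by simp_all
qed

section \<open>Orientations within one outdegree class\<close>

context multigraph begin

text \<open>The rules of \<open>Reverse_minus\<close> and \<open>Reverse_plus\<close> have no case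
  for a failed path search after a flippable pair was found; this shows that the search cannot
  fail.\<close>

lemma flippable_imp_apath:
  assumes D: "D \<in> orientations G" and fl: "flippable k (digraph_of (nv G) D {}) s t"
  shows "\<exists>P. pre_digraph.apath (digraph_of (nv G) D {}) s P t"
proof (rule apath_existsI[OF D], goal_cases)
  case 1
  show ?case using fl by (simp add: flippable_def)
next
  case (2 X)
  have "{e. e < length D \<and> fst (D ! e) \<in> X \<and> snd (D ! e) \<notin> X} = {}"
    using 2(3) length_orientation[OF D] by auto
  then have "cut_size G D X = 0" unfolding cut_out_digraph_of by (simp only: card.empty)
  moreover have "t \<notin> X \<Longrightarrow> k < cut_size G D X" using fl 2(1,2) unfolding flippable_iff[OF D] by blast
  ultimately show ?case by fastforce
qed

text \<open>The arcs in which two orientations of equal outdegrees differ form a balanced digraph,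
  so each lies on a directed cycle of such arcs, and this cycle avoids \<open>F\<close>. In the
  proof, an obstructing set \<open>X\<close> would have a cut that grows because \<open>e\<close>
  enters it, whereas equal outdegrees mean equal cuts.\<close>

lemma cycle_in_diff:
  assumes D: "D \<in> orientations G" and D': "D' \<in> orientations G" and deg: "outdeg D' = outdeg D"
    and e: "e < ne G" "D' ! e \<noteq> D ! e" "D ! e = (u, v)"
    and F: "\<And>f. f < ne G \<Longrightarrow> f \<in> F \<Longrightarrow> D' ! f = D ! f"
  shows "\<exists>P. pre_digraph.apath (digraph_of (nv G) D F) v P u"
proof -
  let ?F = "{e. D' ! e = D ! e}"
  have uv: "u < nv G" "v < nv G" using orientation_arc[OF D e(1)] e(3) by auto
  have "\<exists>P. pre_digraph.apath (digraph_of (nv G) D ?F) v P u"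
  proof (rule apath_existsI[OF D uv(2)], rule ccontr)
    fix X assume X: "X \<subseteq> {..<nv G}" "v \<in> X" "u \<notin> X"
      and closed: "\<And>e. e < ne G \<Longrightarrow> e \<notin> ?F \<Longrightarrow> fst (D ! e) \<in> X \<Longrightarrow> snd (D ! e) \<in> X"
    have "cut_size G D' X = cut_size G D X"
      using cut_diff[OF D D', of X] X(1) finite_subset[of X "{..<nv G}"] deg by auto
    moreover have "cut_size G D' X = cut_size G D X +
        card {e. e < ne G \<and> D' ! e \<noteq> D ! e \<and> fst (D ! e) \<notin> X \<and> snd (D ! e) \<in> X}"
      using closed by (intro cut_closed_diff[OF D D']) auto
    ultimately have "{e. e < ne G \<and> D' ! e \<noteq> D ! e \<and> fst (D ! e) \<notin> X \<and> snd (D ! e) \<in> X} = {}"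
      by simp
    then show False using e X by auto
  qed
  then obtain P where P: "pre_digraph.apath (digraph_of (nv G) D ?F) v P u" by blast
  have "pre_digraph.apath (digraph_of (nv G) D F) v P u"
    by (rule apath_cong[OF P]) (use apath_arcs(1)[OF D P] F length_orientation[OF D] in auto)
  then show ?thesis by blast
qed

definition outdeg_class :: "orientation \<Rightarrow> nat set \<Rightarrow> orientation set" where
  "outdeg_class D F =
     {D' \<in> orientations G. outdeg D' = outdeg D \<and> (\<forall>e<ne G. e \<in> F \<longrightarrow> D' ! e = D ! e)}"

text \<open>An edge has only two directions, so the members that disagree with \<open>D\<close> on
  \<open>e\<close> agree there with the reversed cycle. The cycle avoids \<open>F\<close>, hence
  nothing fixed before is undone.\<close>

lemma outdeg_class_insert_reverse:
  assumes D: "D \<in> orientations G" and e: "e < ne G" "e \<notin> F" "D ! e = (u, v)"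
    and P: "pre_digraph.apath (digraph_of (nv G) D F) v P u"
  shows "outdeg_class (reverse_arcs D (insert e (set P))) (insert e F) =
    {D' \<in> outdeg_class D F. D' ! e \<noteq> D ! e}"
proof -
  let ?D1 = "reverse_arcs D (insert e (set P))"
  note P' = apath_arcs[OF D P]
  have deg: "outdeg ?D1 = outdeg D" by (rule outdeg_reverse_cycle(2)[OF D e(1,3) P])
  have F: "?D1 ! f = D ! f" if "f < ne G" "f \<in> F" for f
    using that P'(1) e(2) length_orientation[OF D] by auto
  have e1: "?D1 ! e = prod.swap (D ! e)" using e(1) length_orientation[OF D] by simp
  have ne: "prod.swap (D ! e) \<noteq> D ! e" using orientation_arc(3)[OF D e(1)] by (cases "D ! e") auto
  have "D' ! e = prod.swap (D ! e) \<longleftrightarrow> D' ! e \<noteq> D ! e" if "D' \<in> orientations G" for D'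
    using ne orientation_flip[OF D that e(1)] by auto
  then show ?thesis using F e1 e(1) unfolding outdeg_class_def deg by auto
qed

lemma k_le_outdeg: 
  assumes "D \<in> k_connected_orientations G k" "nv G \<ge> 2" "v < nv G"
  shows "k \<le> outdeg D v"
proof -
  note D = k_connected_orientation[OF assms(1)]
  have "{v} \<noteq> {..<nv G}"
  proof
    assume "{v} = {..<nv G}"
    then have "card {v} = card {..<nv G}" by simp
    then show False using assms(2) by simp
  qed
  then have "k \<le> cut_size G D {v}" using assms(3) by (intro k_connected_cut[OF assms(1)]) auto
  also have "\<dots> \<le> outdeg D v"
    unfolding cut_out_digraph_of outdeg_def by (intro card_mono) auto
  finally show ?thesis .
qed

end

section \<open>Outputs of the procedures for arbitrary correct subroutines\<close>

locale enumeration = multigraph +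
  fixes k :: nat and S :: subroutines
  assumes subs: "correct_subroutines G k S"
begin

abbreviation "kco \<equiv> k_connected_orientations G k"

lemma finds_path:
  assumes "D \<in> orientations G" "s < nv G" "t < nv G" "s \<noteq> t"
  shows "finds (fst (find_path S D F s t)) (\<lambda>P. pre_digraph.apath (digraph_of (nv G) D F) s P t)"
  using subs assms by (simp add: correct_subroutines_def)

lemma finds_out:
  assumes "D \<in> kco" "F \<subseteq> {..<nv G}" "v < nv G" "v \<notin> F"
  shows "finds (fst (find_out S D F v))
    (\<lambda>u. u \<in> {..<nv G} - F \<and> u \<noteq> v \<and> flippable k (digraph_of (nv G) D {}) v u)"
  using subs assms by (simp add: correct_subroutines_def)

lemma finds_in:
  assumes "D \<in> kco" "F \<subseteq> {..<nv G}" "v < nv G" "v \<notin> F"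
  shows "finds (fst (find_in S D F v))
    (\<lambda>u. u \<in> {..<nv G} - F \<and> u \<noteq> v \<and> flippable k (digraph_of (nv G) D {}) u v)"
  using subs assms by (simp add: correct_subroutines_def)

lemma EnOPODS_cycle:
  assumes D: "D \<in> orientations G" and e: "\<not> {..<length D} \<subseteq> F" "e = Min ({..<length D} - F)" "D ! e = (u, v)"
    and P: "find_path S D F v u = (Some P, t)"
  shows "e < ne G" "e \<notin> F" "pre_digraph.apath (digraph_of (nv G) D F) v P u"
proof -
  show *: "e < ne G" "e \<notin> F" using Min_unfixed[OF e(1,2)] length_orientation[OF D] by auto
  show "pre_digraph.apath (digraph_of (nv G) D F) v P u"
    using finds_path[OF D, of v u F] orientation_arc[OF D *(1)] e(3) P by (simp add: finds_Some)
qed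

lemma EnOPODS_outputs:
  assumes "EnOPODS (nv G) S D F tr" "D \<in> orientations G"
  shows "distinct (outputs tr) \<and> set (outputs tr) = outdeg_class D F"
  using assms
proof (induction rule: EnOPODS.induct)
  case (all_fixed D F)
  then have "outdeg_class D F = {D}"
    using length_orientation[OF all_fixed.prems] orientation_eqI
    by (fastforce simp: outdeg_class_def)
  then show ?case by simp
next
  case (no_cycle D F e u v tr1 t)
  note D = no_cycle.prems
  note e = Min_unfixed[OF no_cycle.hyps(1,2), unfolded length_orientation[OF D]]
  have no_path: "\<nexists>P. pre_digraph.apath (digraph_of (nv G) D F) v P u"
    using finds_path[OF D, of v u F] orientation_arc[OF D e(1)] no_cycle.hyps(3,5) by (simp add: finds_None)
  \<comment> \<open>A member with \<open>e\<close> reversed would yield a directed cycle through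
    \<open>e\<close> outside \<open>F\<close>, which the failed search excludes. So leaving out the
    second call loses nothing.\<close>
  then have "D' ! e = D ! e" if "D' \<in> outdeg_class D F" for D'
    using cycle_in_diff[OF D, of D' e u v F] that e(1) no_cycle.hyps(3) by (auto simp: outdeg_class_def)
  then have "outdeg_class D (insert e F) = outdeg_class D F"
    using e(1) by (auto simp: outdeg_class_def)
  then show ?case using no_cycle.IH[OF D] by simp
next
  case (cycle D F e u v tr1 P t tr2)
  note D = cycle.prems
  note c = EnOPODS_cycle[OF D cycle.hyps(1,2,3,5)]
  have "outdeg_class D (insert e F) = {D' \<in> outdeg_class D F. D' ! e = D ! e}"
    using c(1) by (auto simp: outdeg_class_def)
  then show ?case
    using cycle.IH(1)[OF D] cycle.IH(2)[OF reverse_orientation[OF D]]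
      outdeg_class_insert_reverse[OF D c(1,2) cycle.hyps(3) c(3)] by auto
qed

text \<open>The procedure is a relation, so termination means existence of a trace; every recursive
  call fixes one more edge.\<close>

lemma EnOPODS_exists:
  assumes "D \<in> orientations G"
  shows "\<exists>tr. EnOPODS (nv G) S D F tr"
  using assms
proof (induction "card ({..<ne G} - F)" arbitrary: D F rule: less_induct)
  case less
  note D = less.prems
  show ?case
  proof (cases "{..<length D} \<subseteq> F")
    case True
    then show ?thesis using EnOPODS.all_fixed by blast
  next
    case False
    define e where "e = Min ({..<length D} - F)"
    obtain u v where uv: "D ! e = (u, v)" by fastforce
    have e: "e < ne G" "e \<notin> F"
      using Min_unfixed[OF False e_def] length_orientation[OF D] by auto
    have "card ({..<ne G} - insert e F) < card ({..<ne G} - F)"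
      using e by (intro psubset_card_mono) auto
    note IH = less.hyps[OF this]
    obtain tr1 where tr1: "EnOPODS (nv G) S D (insert e F) tr1" using IH[OF D] by blast
    obtain r t where r: "find_path S D F v u = (r, t)" by fastforce
    show ?thesis
    proof (cases r)
      case None
      then show ?thesis using EnOPODS.no_cycle[OF False e_def uv tr1] r by blast
    next
      case (Some P)
      obtain tr2 where "EnOPODS (nv G) S (reverse_arcs D (insert e (set P))) (insert e F) tr2"
        using IH[OF reverse_orientation[OF D]] by blast
      then show ?thesis using EnOPODS.cycle[OF False e_def uv tr1] r Some by blast
    qed
  qed
qed

lemma flip_out:
  assumes D: "D \<in> kco" and F: "F \<subseteq> {..<nv G}" "v < nv G" "v \<notin> F"
    and u: "find_out S D F v = (Some u, t)" and P: "find_path S D {} v u = (Some P, t')"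
  shows "reverse_arcs D (set P) \<in> kco"
    and "outdeg D v = Suc (outdeg (reverse_arcs D (set P)) v)"
    and "\<And>w. w \<in> F \<Longrightarrow> outdeg (reverse_arcs D (set P)) w = outdeg D w"
    and "u < nv G" "u \<noteq> v"
proof -
  have O: "D \<in> orientations G" by (rule k_connected_orientation[OF D])
  have u': "u < nv G" "u \<notin> F" "u \<noteq> v" "flippable k (digraph_of (nv G) D {}) v u"
    using finds_out[OF D F] u by (auto simp: finds_Some)
  then show "u < nv G" "u \<noteq> v" by auto
  have P': "pre_digraph.apath (digraph_of (nv G) D {}) v P u"
    using finds_path[OF O F(2) u'(1), of "{}"] u'(3) P by (simp add: finds_Some)
  show "reverse_arcs D (set P) \<in> kco" by (rule k_connected_flip[OF D u'(4) P'])
  show "outdeg D v = Suc (outdeg (reverse_arcs D (set P)) v)"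
    using outdeg_reverse_path[OF O P', of v] u'(3) by simp
  show "outdeg (reverse_arcs D (set P)) w = outdeg D w" if "w \<in> F" for w
    using outdeg_reverse_path[OF O P', of w] u'(2) F(3) that by (auto simp: of_bool_def split: if_splits)
qed

lemma flip_in:
  assumes D: "D \<in> kco" and F: "F \<subseteq> {..<nv G}" "v < nv G" "v \<notin> F"
    and u: "find_in S D F v = (Some u, t)" and P: "find_path S D {} u v = (Some P, t')"
  shows "reverse_arcs D (set P) \<in> kco"
    and "outdeg (reverse_arcs D (set P)) v = Suc (outdeg D v)"
    and "\<And>w. w \<in> F \<Longrightarrow> outdeg (reverse_arcs D (set P)) w = outdeg D w"
    and "u < nv G" "u \<noteq> v"
proof -
  have O: "D \<in> orientations G" by (rule k_connected_orientation[OF D])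
  have u': "u < nv G" "u \<notin> F" "u \<noteq> v" "flippable k (digraph_of (nv G) D {}) u v"
    using finds_in[OF D F] u by (auto simp: finds_Some)
  then show "u < nv G" "u \<noteq> v" by auto
  have P': "pre_digraph.apath (digraph_of (nv G) D {}) u P v"
    using finds_path[OF O u'(1) F(2), of "{}"] u'(3) P by (simp add: finds_Some)
  show "reverse_arcs D (set P) \<in> kco" by (rule k_connected_flip[OF D u'(4) P'])
  show "outdeg (reverse_arcs D (set P)) v = Suc (outdeg D v)"
    using outdeg_reverse_path[OF O P', of v] u'(3) by simp
  show "outdeg (reverse_arcs D (set P)) w = outdeg D w" if "w \<in> F" for w
    using outdeg_reverse_path[OF O P', of w] u'(2) F(3) that by (auto simp: of_bool_def split: if_splits)
qed

text \<open>A failed search means that \<open>v\<close> already has its least outdegree among the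
  \<open>k\<close>-connected orientations that share the outdegrees on \<open>F\<close>, so ending
  the chain of flips misses no output.\<close>

lemma out_stop:
  assumes D: "D \<in> kco" and F: "F \<subseteq> {..<nv G}" "v < nv G" "v \<notin> F"
    and "find_out S D F v = (None, t)" and "D' \<in> kco" "\<forall>w\<in>F. outdeg D' w = outdeg D w"
  shows "\<not> outdeg D' v < outdeg D v"
  using finds_out[OF D F] flippable_out_exists[OF D assms(6) F(2), of F] assms(5,7)
  by (auto simp: finds_None)

lemma in_stop:
  assumes D: "D \<in> kco" and F: "F \<subseteq> {..<nv G}" "v < nv G" "v \<notin> F"
    and "find_in S D F v = (None, t)" and "D' \<in> kco" "\<forall>w\<in>F. outdeg D' w = outdeg D w"
  shows "\<not> outdeg D v < outdeg D' v"
  using finds_in[OF D F] flippable_in_exists[OF D assms(6) F(2), of F] assms(5,7)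
  by (auto simp: finds_None)

text \<open>What a call of \<open>EnODS'\<close> has to output. It depends on \<open>D\<close> only
  through the outdegrees on \<open>F\<close>, so flips between vertices outside \<open>F\<close>
  leave it unchanged.\<close>

definition vertex_class :: "orientation \<Rightarrow> nat set \<Rightarrow> orientation set" where
  "vertex_class D F = {D' \<in> kco. \<forall>w\<in>F. outdeg D' w = outdeg D w}"

lemma vertex_class_all_fixed:
  assumes "D \<in> kco" "{..<nv G} \<subseteq> F" "F \<subseteq> {..<nv G}"
  shows "vertex_class D F = outdeg_class D {}"
proof -
  \<comment> \<open>Equality in \<open>outdeg_class\<close> compares outdegrees at all natural
    numbers, hence also at those that are not vertices.\<close>
  have zero: "outdeg D' v = 0" if "D' \<in> orientations G" "\<not> v < nv G" for D' v
  proof -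
    have "{e. e < length D' \<and> fst (D' ! e) = v} = {}"
      using orientation_arc(1)[OF that(1)] length_orientation[OF that(1)] that(2) by auto
    then show ?thesis by (simp add: outdeg_def)
  qed
  have deg: "outdeg D' = outdeg D" if D': "D' \<in> vertex_class D F" for D'
  proof
    fix v
    show "outdeg D' v = outdeg D v"
    proof (cases "v < nv G")
      case True
      then have "v \<in> F" using assms(2) by auto
      then show ?thesis using D' by (simp add: vertex_class_def)
    next
      case False
      then show ?thesis
        using D' zero[of D'] zero[of D] k_connected_orientation[of _ k] assms(1) by (simp add: vertex_class_def)
    qed
  qed
  show ?thesis
  proof (rule set_eqI)
    fix D'
    show "D' \<in> vertex_class D F \<longleftrightarrow> D' \<in> outdeg_class D {}"
      using deg[of D'] k_connected_orientation[of D' k] k_connected_outdeg_cong[OF assms(1), of D']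
      by (auto simp: outdeg_class_def vertex_class_def)
  qed
qed

text \<open>The class is split by the outdegree of \<open>v\<close>: smaller values belong to
  \<open>Reverse_minus\<close>, larger ones to \<open>Reverse_plus\<close>, the current one to the
  last call. After a flip, the inner \<open>EnODS'\<close> takes the neighbouring value and the
  recursive \<open>Reverse\<close> call all values beyond it. The parts are disjoint, so no output
  is repeated.\<close>

lemma enumeration_outputs:
  "Reverse_minus (nv G) S D F v tr \<Longrightarrow> D \<in> kco \<Longrightarrow> F \<subseteq> {..<nv G} \<Longrightarrow> v < nv G \<Longrightarrow> v \<notin> F \<Longrightarrow>
    distinct (outputs tr) \<and> set (outputs tr) = {D' \<in> vertex_class D F. outdeg D' v < outdeg D v}"
  "Reverse_plus (nv G) S D F v tr \<Longrightarrow> D \<in> kco \<Longrightarrow> F \<subseteq> {..<nv G} \<Longrightarrow> v < nv G \<Longrightarrow> v \<notin> F \<Longrightarrow>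
    distinct (outputs tr) \<and> set (outputs tr) = {D' \<in> vertex_class D F. outdeg D v < outdeg D' v}"
  "EnODS' (nv G) S D F tr \<Longrightarrow> D \<in> kco \<Longrightarrow> F \<subseteq> {..<nv G} \<Longrightarrow>
    distinct (outputs tr) \<and> set (outputs tr) = vertex_class D F"
proof (induction rule: Reverse_minus_Reverse_plus_EnODS'.inducts)
  case (minus_stop D F v t)
  then show ?case using out_stop[OF minus_stop.prems minus_stop.IH] by (auto simp: vertex_class_def)
next
  case (minus_flip D F v u t P t' tr1 tr2)
  note fl = flip_out[OF minus_flip.prems minus_flip.IH(1,2)]
  have "vertex_class (reverse_arcs D (set P)) (insert v F) =
      {D' \<in> vertex_class D F. Suc (outdeg D' v) = outdeg D v}"
    using fl(2,3) by (auto simp: vertex_class_def)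
  moreover have "vertex_class (reverse_arcs D (set P)) F = vertex_class D F"
    using fl(3) by (auto simp: vertex_class_def)
  ultimately show ?case
    using minus_flip.IH(4)[OF fl(1) minus_flip.prems(2-4)] minus_flip.IH(6)[OF fl(1)] fl(2) minus_flip.prems(2,3)
    by auto
next
  case (plus_stop D F v t)
  then show ?case using in_stop[OF plus_stop.prems plus_stop.IH] by (auto simp: vertex_class_def)
next
  case (plus_flip D F v u t P t' tr1 tr2)
  note fl = flip_in[OF plus_flip.prems plus_flip.IH(1,2)]
  have "vertex_class (reverse_arcs D (set P)) (insert v F) =
      {D' \<in> vertex_class D F. outdeg D' v = Suc (outdeg D v)}"
    using fl(2,3) by (auto simp: vertex_class_def)
  moreover have "vertex_class (reverse_arcs D (set P)) F = vertex_class D F"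
    using fl(3) by (auto simp: vertex_class_def)
  ultimately show ?case
    using plus_flip.IH(4)[OF fl(1) plus_flip.prems(2-4)] plus_flip.IH(6)[OF fl(1)] fl(2) plus_flip.prems(2,3)
    by auto
next
  case (ods_step F v D tr1 tr2 tr3)
  note v = Min_unfixed[OF ods_step.IH(1,2)]
  have "vertex_class D (insert v F) = {D' \<in> vertex_class D F. outdeg D' v = outdeg D v}"
    by (auto simp: vertex_class_def)
  then show ?case
    using ods_step.IH(4)[OF ods_step.prems v] ods_step.IH(6)[OF ods_step.prems v]
      ods_step.IH(8)[OF ods_step.prems(1)] ods_step.prems(2) v
    by (auto simp: nat_neq_iff)
next
  case (ods_all_fixed F D tr)
  then show ?case
    using EnOPODS_outputs[OF ods_all_fixed.IH(2)] k_connected_orientation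
      vertex_class_all_fixed[OF ods_all_fixed.prems(1) ods_all_fixed.IH(1) ods_all_fixed.prems(2)] by simp
qed


section \<open>Termination of the flip procedures\<close>

lemma outdeg_le: "D \<in> orientations G \<Longrightarrow> outdeg D v \<le> ne G"
  unfolding outdeg_def using card_mono[of "{..<ne G}" "{e. e < length D \<and> fst (D ! e) = v}"]
  by (auto simp: length_orientation)

lemma Reverse_minus_exists:
  assumes IH: "\<And>D. D \<in> kco \<Longrightarrow> \<exists>tr. EnODS' (nv G) S D (insert v F) tr"
    and "D \<in> kco" and F: "F \<subseteq> {..<nv G}" "v < nv G" "v \<notin> F"
  shows "\<exists>tr. Reverse_minus (nv G) S D F v tr"
  using assms(2)
proof (induction "outdeg D v" arbitrary: D rule: less_induct)
  case less
  note D = less.prems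
  obtain r t where r: "find_out S D F v = (r, t)" by fastforce
  show ?case
  proof (cases r)
    case None
    then show ?thesis using r Reverse_minus_Reverse_plus_EnODS'.minus_stop by blast
  next
    case (Some u)
    obtain q t' where q: "find_path S D {} v u = (q, t')" by fastforce
    have u: "u < nv G" "u \<noteq> v" "flippable k (digraph_of (nv G) D {}) v u"
      using finds_out[OF D F] r Some by (auto simp: finds_Some)
    then obtain P where P: "q = Some P"
      using flippable_imp_apath[OF k_connected_orientation[OF D] u(3)] q F(2)
        finds_path[OF k_connected_orientation[OF D] F(2) u(1), of "{}"] by (cases q) (auto simp: finds_None)
    note fl = flip_out[OF D F r[unfolded Some] q[unfolded P]]
    obtain tr1 where "Reverse_minus (nv G) S (reverse_arcs D (set P)) F v tr1"
      using less.hyps[OF _ fl(1)] fl(2) by auto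
    moreover obtain tr2 where "EnODS' (nv G) S (reverse_arcs D (set P)) (insert v F) tr2"
      using IH[OF fl(1)] by blast
    ultimately show ?thesis
      using Reverse_minus_Reverse_plus_EnODS'.minus_flip r q Some P by blast
  qed
qed

lemma Reverse_plus_exists:
  assumes IH: "\<And>D. D \<in> kco \<Longrightarrow> \<exists>tr. EnODS' (nv G) S D (insert v F) tr"
    and "D \<in> kco" and F: "F \<subseteq> {..<nv G}" "v < nv G" "v \<notin> F"
  shows "\<exists>tr. Reverse_plus (nv G) S D F v tr"
  using assms(2)
proof (induction "ne G - outdeg D v" arbitrary: D rule: less_induct)
  case less
  note D = less.prems
  obtain r t where r: "find_in S D F v = (r, t)" by fastforce
  show ?case
  proof (cases r)
    case None
    then show ?thesis using r Reverse_minus_Reverse_plus_EnODS'.plus_stop by blast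
  next
    case (Some u)
    obtain q t' where q: "find_path S D {} u v = (q, t')" by fastforce
    have u: "u < nv G" "u \<noteq> v" "flippable k (digraph_of (nv G) D {}) u v"
      using finds_in[OF D F] r Some by (auto simp: finds_Some)
    then obtain P where P: "q = Some P"
      using flippable_imp_apath[OF k_connected_orientation[OF D] u(3)] q F(2)
        finds_path[OF k_connected_orientation[OF D] u(1) F(2), of "{}"] by (cases q) (auto simp: finds_None)
    note fl = flip_in[OF D F r[unfolded Some] q[unfolded P]]
    \<comment> \<open>The truncated difference drops because the new outdegree is still at most
      \<open>ne G\<close>.\<close>
    have "ne G - outdeg (reverse_arcs D (set P)) v < ne G - outdeg D v"
      using fl(2) outdeg_le[OF k_connected_orientation[OF fl(1)], of v] by simp
    then obtain tr1 where "Reverse_plus (nv G) S (reverse_arcs D (set P)) F v tr1"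
      using less.hyps[OF _ fl(1)] by auto
    moreover obtain tr2 where "EnODS' (nv G) S (reverse_arcs D (set P)) (insert v F) tr2"
      using IH[OF fl(1)] by blast
    ultimately show ?thesis
      using Reverse_minus_Reverse_plus_EnODS'.plus_flip r q Some P by blast
  qed
qed

lemma EnODS'_exists:
  assumes "D \<in> kco" "F \<subseteq> {..<nv G}"
  shows "\<exists>tr. EnODS' (nv G) S D F tr"
  using assms
proof (induction "card ({..<nv G} - F)" arbitrary: D F rule: less_induct)
  case less
  show ?case
  proof (cases "{..<nv G} \<subseteq> F")
    case True
    then show ?thesis
      using EnOPODS_exists[OF k_connected_orientation[OF less.prems(1)]]
        Reverse_minus_Reverse_plus_EnODS'.ods_all_fixed by blast
  next
    case False
    define v where "v = Min ({..<nv G} - F)"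
    note v = Min_unfixed[OF False v_def]
    have "card ({..<nv G} - insert v F) < card ({..<nv G} - F)"
      using v by (intro psubset_card_mono) auto
    then have IH: "\<exists>tr. EnODS' (nv G) S D (insert v F) tr" if "D \<in> kco" for D
      using less.hyps that less.prems(2) v by auto
    show ?thesis
      using Reverse_minus_exists[OF IH less.prems v] Reverse_plus_exists[OF IH less.prems v] IH[OF less.prems(1)]
        Reverse_minus_Reverse_plus_EnODS'.ods_step[OF False v_def] by blast
  qed
qed

lemma algorithm4_exists:
  assumes "correct_start G k I"
  shows "\<exists>tr. algorithm4 G S I tr"
proof (cases I)
  case (Pair r t)
  show ?thesis
  proof (cases r)
    case None
    then show ?thesis using Pair algorithm4.infeasible by blast
  next
    case (Some D)
    then have "D \<in> kco" using assms Pair by (simp add: correct_start_def finds_Some)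
    then show ?thesis using EnODS'_exists[of D "{}"] algorithm4.feasible Pair Some by blast
  qed
qed

lemma algorithm4_outputs:
  assumes "correct_start G k I" "algorithm4 G S I tr"
  shows "distinct (outputs tr) \<and> set (outputs tr) = kco"
  using assms(2)
proof cases
  case (infeasible t)
  then show ?thesis using assms(1) by (auto simp: correct_start_def finds_None)
next
  case (feasible D tr' t)
  then have "D \<in> kco" using assms by (simp add: correct_start_def finds_Some)
  then show ?thesis
    using enumeration_outputs(3)[OF feasible(3)] feasible(2) by (simp add: vertex_class_def)
qed

end

section \<open>Orientations with equal outdegrees\<close>

text \<open>The \<open>LEAST\<close> terms are distances from \<open>r\<close>: the last step of a
  shortest walk to \<open>x\<close> starts at a vertex closer to \<open>r\<close>.\<close>

lemma relpow_LEAST_step: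
  assumes "(r, x) \<in> R\<^sup>*" "x \<noteq> r"
  shows "\<exists>w. (w, x) \<in> R \<and> (LEAST j. (r, w) \<in> R ^^ j) < (LEAST j. (r, x) \<in> R ^^ j)"
proof -
  let ?j = "LEAST j. (r, x) \<in> R ^^ j"
  have "(r, x) \<in> R ^^ ?j" using assms(1) by (metis (mono_tags, lifting) LeastI rtrancl_imp_relpow)
  moreover have "?j \<noteq> 0" using calculation assms(2) by (metis IdE relpow.simps(1) fst_conv snd_conv pair_in_Id_conv)
  ultimately obtain i w where i: "?j = Suc i" and w: "(r, w) \<in> R ^^ i" "(w, x) \<in> R"
    by (metis not0_implies_Suc relpow_Suc_E)
  have "(LEAST j. (r, w) \<in> R ^^ j) \<le> i" by (rule Least_le[of "\<lambda>j. (r, w) \<in> R ^^ j", OF w(1)])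
  then show ?thesis using i w(2) by auto
qed

context multigraph begin

text \<open>
  Fix an in-tree towards vertex \<open>0\<close> and order the vertices by their distance from \<open>0\<close>. Every
  non-tree arc \<open>e\<close> lies on a directed cycle all of whose other non-tree arcs have a tail closer
  to \<open>0\<close>; hence the cycles of different non-tree arcs are different.
\<close>

lemma card_outdeg_class:
  assumes Dk: "D \<in> k_connected_orientations G k" and "k \<ge> 1" "nv G \<ge> 1"
  shows "ne G + 1 \<le> nv G + card (outdeg_class D {})"
proof -
  have D: "D \<in> orientations G" by (rule k_connected_orientation[OF Dk])
  define R where "R = {(x, y). \<exists>e<ne G. D ! e = (x, y)}"
  have leave: "\<exists>e<ne G. fst (D ! e) \<in> X \<and> snd (D ! e) \<notin> X" if "X \<noteq> {}" "X \<subset> {..<nv G}" for X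
  proof (rule ccontr)
    assume "\<not> ?thesis"
    then have "{e. e < length D \<and> fst (D ! e) \<in> X \<and> snd (D ! e) \<notin> X} = {}"
      using length_orientation[OF D] by auto
    then have "cut_size G D X = 0" unfolding cut_out_digraph_of by (simp only: card.empty)
    then show False using k_connected_cut[OF Dk that] \<open>k \<ge> 1\<close> by simp
  qed
  have arc_R: "(fst (D ! e), snd (D ! e)) \<in> R" if "e < ne G" for e
    using that by (auto simp: R_def)
  have from0: "(0, x) \<in> R\<^sup>*" if x: "x < nv G" for x
  proof (rule ccontr)
    assume nx: "(0, x) \<notin> R\<^sup>*"
    let ?X = "{y. y < nv G \<and> (0, y) \<in> R\<^sup>*}"
    have "0 \<in> ?X" using \<open>nv G \<ge> 1\<close> by simp
    then have "?X \<noteq> {}" by blast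
    moreover have "?X \<subset> {..<nv G}" using nx x by blast
    ultimately obtain e where e: "e < ne G" "fst (D ! e) \<in> ?X" "snd (D ! e) \<notin> ?X"
      using leave[of ?X] by auto
    then have "(0, snd (D ! e)) \<in> R\<^sup>*" using rtrancl_into_rtrancl[OF _ arc_R[OF e(1)]] by simp
    then show False using e(3) orientation_arc(2)[OF D e(1)] by simp
  qed
  have to0: "(x, 0) \<in> R\<^sup>*" if x: "x < nv G" for x
  proof (rule ccontr)
    assume nx: "(x, 0) \<notin> R\<^sup>*"
    let ?X = "{y. y < nv G \<and> (y, 0) \<notin> R\<^sup>*}"
    have "?X \<noteq> {}" using nx x by auto
    moreover have "0 \<in> {..<nv G} - ?X" using x by simp
    then have "?X \<subset> {..<nv G}" by blast
    ultimately obtain e where e: "e < ne G" "fst (D ! e) \<in> ?X" "snd (D ! e) \<notin> ?X"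
      using leave[of ?X] by auto
    then have "(snd (D ! e), 0) \<in> R\<^sup>*" using orientation_arc(2)[OF D e(1)] by simp
    then have "(fst (D ! e), 0) \<in> R\<^sup>*" by (rule converse_rtrancl_into_rtrancl[OF arc_R[OF e(1)]])
    then show False using e(2) by simp
  qed
  \<comment> \<open>Two distances are needed: \<open>key\<close>, from 0, orders the tails of the
    non-tree arcs, while \<open>key'\<close>, towards 0, selects the in-tree.\<close>
  define key where "key x = (LEAST j. (0, x) \<in> R ^^ j)" for x
  define key' where "key' x = (LEAST j. (0, x) \<in> (R\<inverse>) ^^ j)" for x
  have "\<forall>x\<in>{..<nv G} - {0}. \<exists>e<ne G. fst (D ! e) = x \<and> key' (snd (D ! e)) < key' x"
  proof
    fix x assume x: "x \<in> {..<nv G} - {0}"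
    then have "(0, x) \<in> (R\<inverse>)\<^sup>*" using to0 by (simp add: rtrancl_converse)
    then obtain w where "(w, x) \<in> R\<inverse>" "key' w < key' x"
      using relpow_LEAST_step[of 0 x "R\<inverse>"] x unfolding key'_def by auto
    then show "\<exists>e<ne G. fst (D ! e) = x \<and> key' (snd (D ! e)) < key' x" by (auto simp: R_def)
  qed
  then obtain par where par: "\<And>x. x < nv G \<Longrightarrow> x \<noteq> 0 \<Longrightarrow> par x < ne G \<and> fst (D ! par x) = x \<and>
      key' (snd (D ! par x)) < key' x"
    by (metis DiffI lessThan_iff singletonD)
  define T where "T = par ` ({..<nv G} - {0})"
  define A where "A e = T \<union> {f. key (fst (D ! f)) < key (fst (D ! e))}" for e
  have "\<forall>e<ne G. \<exists>P. pre_digraph.apath (digraph_of (nv G) D (- A e)) (snd (D ! e)) P (fst (D ! e))"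
  proof (intro allI impI)
    fix e assume e: "e < ne G"
    show "\<exists>P. pre_digraph.apath (digraph_of (nv G) D (- A e)) (snd (D ! e)) P (fst (D ! e))"
    proof (rule apath_existsI[OF D orientation_arc(2)[OF D e]])
      fix X assume X: "X \<subseteq> {..<nv G}" "snd (D ! e) \<in> X"
        and closed: "\<And>f. f < ne G \<Longrightarrow> f \<notin> - A e \<Longrightarrow> fst (D ! f) \<in> X \<Longrightarrow> snd (D ! f) \<in> X"
      \<comment> \<open>Tree arcs are always available, and following them from any vertex ends in
        0.\<close>
      have "0 \<in> X" if "z \<in> X" for z
        using that
      proof (induction "key' z" arbitrary: z rule: less_induct)
        case less
        show ?case
        proof (cases "z = 0")
          case False
          moreover have "z < nv G" using less.prems X(1) by auto
          ultimately have "par z < ne G" "fst (D ! par z) = z" "key' (snd (D ! par z)) < key' z" "par z \<in> T"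
            using par[of z] by (auto simp: T_def)
          then show ?thesis using closed[of "par z"] less by (auto simp: A_def)
        qed (use less in simp)
      qed
      then have "0 \<in> X" using X(2) by blast
      \<comment> \<open>A shortest walk from 0 to the tail of \<open>e\<close> uses only arcs whose
        tails are strictly closer to 0; all of them belong to \<open>A e\<close>.\<close>
      have "w \<in> X" if "w < nv G" "key w \<le> key (fst (D ! e))" for w
        using that
      proof (induction "key w" arbitrary: w rule: less_induct)
        case less
        show ?case
        proof (cases "w = 0")
          case False
          then obtain w' where w': "(w', w) \<in> R" "key w' < key w"
            using relpow_LEAST_step[OF from0[OF less.prems(1)]] unfolding key_def by auto
          then obtain f where f: "f < ne G" "D ! f = (w', w)" by (auto simp: R_def)
          then have "w' < nv G" using orientation_arc(1)[OF D f(1)] by simp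
          then have "w' \<in> X" using less w' by auto
          moreover have "f \<in> A e" using f w' less.prems by (simp add: A_def)
          ultimately show ?thesis using closed[OF f(1)] f(2) by auto
        qed (use \<open>0 \<in> X\<close> in simp)
      qed
      then show "fst (D ! e) \<in> X" using orientation_arc(1)[OF D e] by simp
    qed
  qed
  then obtain P where P: "\<And>e. e < ne G \<Longrightarrow>
      pre_digraph.apath (digraph_of (nv G) D (- A e)) (snd (D ! e)) (P e) (fst (D ! e))"
    by metis
  define N where "N = {..<ne G} - T"
  define C where "C e = insert e (set (P e))" for e
  have C: "C e \<subseteq> {..<ne G}" if "e < ne G" for e
    using apath_arcs(1)[OF D P[OF that]] that by (auto simp: C_def)
  have diff: "{i. i < ne G \<and> reverse_arcs D (C e) ! i \<noteq> D ! i} = C e" if "e < ne G" for e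
  proof -
    have ne: "prod.swap (D ! i) \<noteq> D ! i" if "i < ne G" for i
      using orientation_arc(3)[OF D that] by (cases "D ! i") auto
    have "reverse_arcs D (C e) ! i \<noteq> D ! i \<longleftrightarrow> i \<in> C e" if "i < ne G" for i
      using ne[OF that] that length_orientation[OF D] by simp
    then show ?thesis using C[OF that] by blast
  qed
  have key_less: "f = e \<or> key (fst (D ! f)) < key (fst (D ! e))" if "e \<in> N" "f \<in> N" "f \<in> C e" for e f
  proof -
    have "f \<in> A e" if "f \<noteq> e"
      using that \<open>f \<in> C e\<close> apath_arcs(1)[OF D P, of e] \<open>e \<in> N\<close> by (auto simp: C_def N_def)
    then show ?thesis using \<open>f \<in> N\<close> by (auto simp: A_def N_def)
  qed
  \<comment> \<open>\<open>C e\<close> is recovered as the set of changed edges. Two different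
    non-tree arcs with the same cycle would each have a tail strictly closer to 0 than that of the
    other.\<close>
  have "inj_on (\<lambda>e. reverse_arcs D (C e)) N"
  proof (rule inj_onI)
    fix e f assume N: "e \<in> N" "f \<in> N" and eq: "reverse_arcs D (C e) = reverse_arcs D (C f)"
    have "e < ne G" "f < ne G" using N by (simp_all add: N_def)
    then have "C e = C f" using eq by (metis (no_types) diff)
    moreover have "e \<in> C e" "f \<in> C f" by (simp_all add: C_def)
    ultimately have "f \<in> C e" "e \<in> C f" by simp_all
    then show "e = f" using key_less[OF N] key_less[OF N(2,1)] by auto
  qed
  moreover have "(\<lambda>e. reverse_arcs D (C e)) ` N \<subseteq> outdeg_class D {}"
  proof safe
    fix e assume "e \<in> N"
    then have e: "e < ne G" by (simp add: N_def)
    show "reverse_arcs D (C e) \<in> outdeg_class D {}"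
      using outdeg_reverse_cycle(2)[OF D e _ P[OF e]] reverse_orientation[OF D]
      by (simp add: outdeg_class_def C_def)
  qed
  moreover have "finite (outdeg_class D {})"
    using finite_orientations by (rule rev_finite_subset) (auto simp: outdeg_class_def)
  ultimately have "card N \<le> card (outdeg_class D {})" by (rule card_inj_on_le)
  moreover have "ne G \<le> card N + card T"
    using diff_card_le_card_Diff[of T "{..<ne G}"] by (simp add: N_def T_def)
  moreover have "card T \<le> nv G - 1"
    using card_image_le[of "{..<nv G} - {0}" par] \<open>nv G \<ge> 1\<close> by (simp add: T_def)
  ultimately show ?thesis using \<open>nv G \<ge> 1\<close> by linarith
qed

end

section \<open>Running time\<close>

text \<open>\<open>rest\<close> and \<open>gaps_within\<close> are a form of \<open>gaps\<close>
  that composes: concatenating traces merges the last gap of one with the first gap of the next, so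
  the pending time is passed on and only gaps closed by an output are checked.\<close>

fun rest :: "nat \<Rightarrow> trace \<Rightarrow> nat" where
  "rest a [] = a"
| "rest a (Steps t # tr) = rest (a + t) tr"
| "rest a (Output D # tr) = rest 0 tr"

fun gaps_within :: "nat \<Rightarrow> nat \<Rightarrow> trace \<Rightarrow> bool" where
  "gaps_within B a [] \<longleftrightarrow> True"
| "gaps_within B a (Steps t # tr) \<longleftrightarrow> gaps_within B (a + t) tr"
| "gaps_within B a (Output D # tr) \<longleftrightarrow> a \<le> B \<and> gaps_within B 0 tr"

lemma rest_append [simp]: "rest a (tr @ tr') = rest (rest a tr) tr'"
  by (induction a tr rule: rest.induct) auto

lemma gaps_within_append [simp]:
  "gaps_within B a (tr @ tr') \<longleftrightarrow> gaps_within B a tr \<and> gaps_within B (rest a tr) tr'"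
  by (induction B a tr rule: gaps_within.induct) auto

lemma total_time_append [simp]: "total_time (tr @ tr') = total_time tr + total_time tr'"
  by (induction tr rule: total_time.induct) auto

lemma gaps_le_iff: "(\<forall>g\<in>set (gaps a tr). g \<le> B) \<longleftrightarrow> gaps_within B a tr \<and> rest a tr \<le> B"
  by (induction a tr rule: gaps.induct) auto

lemma delay_leI:
  assumes "gaps_within B 0 tr" "rest 0 tr \<le> B"
  shows "delay tr \<le> B"
proof -
  have "gaps a tr \<noteq> []" for a by (induction a tr rule: gaps.induct) auto
  then have "set (gaps 0 tr) \<noteq> {}" by simp
  then show ?thesis
    using gaps_le_iff[of 0 tr B] assms by (simp add: delay_def)
qed

section \<open>Running time inside one outdegree class\<close>

locale timed_enumeration = enumeration +
  fixes p q :: nat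
  assumes path_time: "\<And>D F s t. D \<in> orientations G \<Longrightarrow> s < nv G \<Longrightarrow> t < nv G \<Longrightarrow> s \<noteq> t \<Longrightarrow>
      snd (find_path S D F s t) \<le> p"
    and out_time: "\<And>D F v. D \<in> kco \<Longrightarrow> F \<subseteq> {..<nv G} \<Longrightarrow> v < nv G \<Longrightarrow> v \<notin> F \<Longrightarrow>
      snd (find_out S D F v) \<le> q"
    and in_time: "\<And>D F v. D \<in> kco \<Longrightarrow> F \<subseteq> {..<nv G} \<Longrightarrow> v < nv G \<Longrightarrow> v \<notin> F \<Longrightarrow>
      snd (find_in S D F v) \<le> q"
begin

text \<open>\<open>opods_cost\<close> and \<open>ods_cost\<close> bound the steps that one call
  spends outside its recursive calls: the entry charge, the searches, and the step on
  return.\<close>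

definition opods_cost :: nat where "opods_cost = nv G + ne G + p + 2"
definition ods_cost :: nat where "ods_cost = nv G + ne G + p + q + 3"

lemma EnOPODS_path_time:
  assumes D: "D \<in> orientations G" and e: "\<not> {..<length D} \<subseteq> F" "e = Min ({..<length D} - F)" "D ! e = (u, v)"
    and "find_path S D F v u = (r, t)"
  shows "t \<le> p" "card ({..<ne G} - F) = Suc (card ({..<ne G} - insert e F))"
proof -
  have *: "e < ne G" "e \<notin> F" using Min_unfixed[OF e(1,2)] length_orientation[OF D] by auto
  show "t \<le> p" using path_time[OF D, of v u F] orientation_arc[OF D *(1)] e(3) assms(5) by auto
  have "{..<ne G} - F = insert e ({..<ne G} - insert e F)" using * by auto
  then show "card ({..<ne G} - F) = Suc (card ({..<ne G} - insert e F))"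
    by (metis card_insert_disjoint finite_Diff finite_lessThan Diff_iff insertI1)
qed

lemma EnOPODS_nonempty:
  assumes "EnOPODS (nv G) S D F tr" "D \<in> orientations G"
  shows "length (outputs tr) \<ge> 1"
proof -
  have "D \<in> set (outputs tr)" using EnOPODS_outputs[OF assms] assms(2) by (simp add: outdeg_class_def)
  then show ?thesis by (cases "outputs tr") auto
qed

text \<open>Each call is paid by the outputs of its first recursive call, which are never missing.
  Along a branch, one call is made per free edge and one at the leaf, which gives the factor per
  output.\<close>

lemma EnOPODS_total_time:
  assumes "EnOPODS (nv G) S D F tr" "D \<in> orientations G"
  shows "total_time tr \<le> (card ({..<ne G} - F) + 1) * opods_cost * length (outputs tr)"
  using assms
proof (induction rule: EnOPODS.induct)
  case (all_fixed D F)
  then show ?case by (simp add: opods_cost_def call_cost_def length_orientation)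
next
  case (no_cycle D F e u v tr1 t)
  note D = no_cycle.prems
  note pt = EnOPODS_path_time[OF D no_cycle.hyps(1,2,3,5)]
  define X where "X = (card ({..<ne G} - insert e F) + 1) * opods_cost"
  have "opods_cost \<le> opods_cost * length (outputs tr1)" using EnOPODS_nonempty[OF no_cycle.hyps(4) D] by simp
  moreover have "total_time tr1 \<le> X * length (outputs tr1)" unfolding X_def by (rule no_cycle.IH[OF D])
  moreover have "call_cost (nv G) D + t + 1 \<le> opods_cost"
    using pt(1) by (simp add: opods_cost_def call_cost_def length_orientation[OF D])
  ultimately have "call_cost (nv G) D + total_time tr1 + t + 1 \<le> (X + opods_cost) * length (outputs tr1)"
    unfolding add_mult_distrib by linarith
  also have "X + opods_cost = (card ({..<ne G} - F) + 1) * opods_cost" by (simp add: X_def pt(2))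
  finally show ?case by simp
next
  case (cycle D F e u v tr1 P t tr2)
  note D = cycle.prems
  note pt = EnOPODS_path_time[OF D cycle.hyps(1,2,3,5)]
  define X where "X = (card ({..<ne G} - insert e F) + 1) * opods_cost"
  have "opods_cost \<le> opods_cost * length (outputs tr1)" using EnOPODS_nonempty[OF cycle.hyps(4) D] by simp
  moreover have "total_time tr1 \<le> X * length (outputs tr1)" unfolding X_def by (rule cycle.IH(1)[OF D])
  moreover have "total_time tr2 \<le> X * length (outputs tr2)"
    unfolding X_def by (rule cycle.IH(2)[OF reverse_orientation[OF D]])
  moreover have "call_cost (nv G) D + t + 1 \<le> opods_cost"
    using pt(1) by (simp add: opods_cost_def call_cost_def length_orientation[OF D])
  ultimately have "call_cost (nv G) D + total_time tr1 + t + total_time tr2 + 1 \<le>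
      (X + opods_cost) * (length (outputs tr1) + length (outputs tr2))"
    unfolding add_mult_distrib add_mult_distrib2 by linarith
  also have "X + opods_cost = (card ({..<ne G} - F) + 1) * opods_cost" by (simp add: X_def pt(2))
  finally show ?case by simp
qed

text \<open>Before the first output lies a descent, after the last one an ascent, each with at most
  one call per free edge plus the leaf. Between two outputs an ascent is followed by a descent,
  hence the factor 2 in the second condition on \<open>B\<close>.\<close>

lemma EnOPODS_gaps:
  assumes "EnOPODS (nv G) S D F tr" "D \<in> orientations G"
    and "a + (card ({..<ne G} - F) + 1) * opods_cost \<le> B" "2 * (ne G + 1) * opods_cost \<le> B"
  shows "gaps_within B a tr \<and> rest a tr \<le> (card ({..<ne G} - F) + 1) * opods_cost"
  using assms
proof (induction arbitrary: a rule: EnOPODS.induct)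
  case (all_fixed D F)
  have "call_cost (nv G) D \<le> opods_cost" "1 \<le> opods_cost"
    using all_fixed.prems(1) by (auto simp: opods_cost_def call_cost_def length_orientation)
  moreover have "opods_cost \<le> (card ({..<ne G} - F) + 1) * opods_cost" by simp
  ultimately have "a + call_cost (nv G) D \<le> B" "1 \<le> (card ({..<ne G} - F) + 1) * opods_cost"
    using all_fixed.prems(2) by linarith+
  then show ?case by simp
next
  case (no_cycle D F e u v tr1 t)
  note D = no_cycle.prems(1)
  note pt = EnOPODS_path_time[OF D no_cycle.hyps(1,2,3,5)]
  define X where "X = (card ({..<ne G} - insert e F) + 1) * opods_cost"
  have XA: "(card ({..<ne G} - F) + 1) * opods_cost = X + opods_cost" by (simp add: X_def pt(2))
  have c: "call_cost (nv G) D + t + 1 \<le> opods_cost"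
    using pt(1) by (simp add: opods_cost_def call_cost_def length_orientation[OF D])
  have "gaps_within B (a + call_cost (nv G) D) tr1 \<and> rest (a + call_cost (nv G) D) tr1 \<le> X"
    unfolding X_def using no_cycle.prems(2) c XA
    by (intro no_cycle.IH[OF D _ no_cycle.prems(3)]) (unfold X_def[symmetric], linarith)
  then show ?case unfolding XA using c by simp
next
  case (cycle D F e u v tr1 P t tr2)
  note D = cycle.prems(1)
  note pt = EnOPODS_path_time[OF D cycle.hyps(1,2,3,5)]
  define X where "X = (card ({..<ne G} - insert e F) + 1) * opods_cost"
  have XA: "(card ({..<ne G} - F) + 1) * opods_cost = X + opods_cost" by (simp add: X_def pt(2))
  have "card ({..<ne G} - F) \<le> ne G" using card_mono[of "{..<ne G}" "{..<ne G} - F"] by auto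
  then have "2 * ((card ({..<ne G} - F) + 1) * opods_cost) \<le> 2 * ((ne G + 1) * opods_cost)"
    by (intro mult_le_mono) auto
  also have "\<dots> \<le> B" using cycle.prems(3) by (simp only: mult.assoc)
  finally have XB: "X + X + opods_cost + opods_cost \<le> B" unfolding XA by simp
  have c: "call_cost (nv G) D + t + 1 \<le> opods_cost"
    using pt(1) by (simp add: opods_cost_def call_cost_def length_orientation[OF D])
  have 1: "gaps_within B (a + call_cost (nv G) D) tr1 \<and> rest (a + call_cost (nv G) D) tr1 \<le> X"
    unfolding X_def using cycle.prems(2) c XA
    by (intro cycle.IH(1)[OF D _ cycle.prems(3)]) (unfold X_def[symmetric], linarith)
  let ?b = "rest (a + call_cost (nv G) D) tr1 + t"
  have "?b + X \<le> B" using conjunct2[OF 1] c XB by linarith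
  then have "gaps_within B ?b tr2 \<and> rest ?b tr2 \<le> X"
    unfolding X_def by (rule cycle.IH(2)[OF reverse_orientation[OF D] _ cycle.prems(3)])
  then show ?case unfolding XA using c 1 by simp
qed

end

lemma unfixed_insert:
  fixes m :: nat
  assumes "v < m" "v \<notin> F"
  shows "{..<m} - F = insert v ({..<m} - insert v F)"
  using assms by auto

lemma card_unfixed_insert:
  fixes m :: nat
  assumes "v < m" "v \<notin> F"
  shows "card ({..<m} - F) = Suc (card ({..<m} - insert v F))"
proof -
  have "card (insert v ({..<m} - insert v F)) = Suc (card ({..<m} - insert v F))"
    by (rule card_insert_disjoint) simp_all
  then show ?thesis by (simp only: unfixed_insert[OF assms, symmetric])
qed

section \<open>Time between consecutive outputs of the whole recursion\<close>

context multigraph begin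

text \<open>\<open>edge_list G\<close> and its reversal are two opposite orientations, so each edge
  counts once at each end, and the degree sum follows by applying
  \<open>sum_outdeg_orientation\<close> twice.\<close>

definition degree :: "nat \<Rightarrow> nat" where
  "degree v = outdeg (edge_list G) v + outdeg (map prod.swap (edge_list G)) v"

lemma outdeg_le_degree:
  assumes "D \<in> orientations G"
  shows "outdeg D v \<le> degree v"
proof -
  have "{e. e < length D \<and> fst (D ! e) = v} \<subseteq> {e. e < ne G \<and> fst (edge_list G ! e) = v} \<union>
      {e. e < ne G \<and> fst (map prod.swap (edge_list G) ! e) = v}"
  proof
    fix e assume e: "e \<in> {e. e < length D \<and> fst (D ! e) = v}"
    then have "D ! e = edge_list G ! e \<or> D ! e = prod.swap (edge_list G ! e)" "e < length (edge_list G)"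
      using assms by (auto simp: orientations_def ne_def)
    then show "e \<in> {e. e < ne G \<and> fst (edge_list G ! e) = v} \<union>
      {e. e < ne G \<and> fst (map prod.swap (edge_list G) ! e) = v}" using e by (auto simp: ne_def)
  qed
  then have "outdeg D v \<le> card ({e. e < ne G \<and> fst (edge_list G ! e) = v} \<union>
      {e. e < ne G \<and> fst (map prod.swap (edge_list G) ! e) = v})"
    unfolding outdeg_def by (rule card_mono[rotated]) simp
  also have "\<dots> \<le> degree v"
    unfolding degree_def outdeg_def length_map ne_def by (rule card_Un_le)
  finally show ?thesis .
qed

lemma sum_degree: "(\<Sum>v<nv G. degree v) = 2 * ne G"
proof -
  have "edge_list G \<in> orientations G" "map prod.swap (edge_list G) \<in> orientations G"
    by (auto simp: orientations_def ne_def)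
  then show ?thesis
    unfolding degree_def sum.distrib by (simp only: sum_outdeg_orientation mult_2)
qed

end

context timed_enumeration begin

text \<open>Budget for the time since the last output when a call of \<open>EnODS'\<close> ends: the
  ascent inside \<open>EnOPODS\<close> and one returning step for each level above it.\<close>

definition gap_after :: "nat set \<Rightarrow> nat" where
  "gap_after F = (ne G + 1) * opods_cost + 1 + card ({..<nv G} - F)"

text \<open>Budget for the time until the first output of a call of \<open>EnODS'\<close>: the
  descent inside \<open>EnOPODS\<close>, the call with all vertices fixed, and for each free vertex
  a chain of flips with three further units.\<close>

definition gap_before :: "nat set \<Rightarrow> nat" where
  "gap_before F = (ne G + 1) * opods_cost + ods_cost + (\<Sum>v\<in>{..<nv G} - F. degree v * ods_cost + 3 * ods_cost)"

lemma gap_after_insert: "v < nv G \<Longrightarrow> v \<notin> F \<Longrightarrow> gap_after F = gap_after (insert v F) + 1"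
  using card_unfixed_insert[of v "nv G" F] by (simp add: gap_after_def)

lemma gap_before_insert:
  assumes "v < nv G" "v \<notin> F"
  shows "gap_before F = gap_before (insert v F) + degree v * ods_cost + 3 * ods_cost"
proof -
  let ?f = "\<lambda>v. degree v * ods_cost + 3 * ods_cost"
  have "sum ?f (insert v ({..<nv G} - insert v F)) = ?f v + sum ?f ({..<nv G} - insert v F)"
    by (rule sum.insert) auto
  then have "sum ?f ({..<nv G} - F) = ?f v + sum ?f ({..<nv G} - insert v F)"
    by (simp only: unfixed_insert[OF assms, symmetric])
  then show ?thesis unfolding gap_before_def by linarith
qed

lemma gap_after_le: "gap_after F \<le> gap_after {}"
  using card_mono[of "{..<nv G}" "{..<nv G} - F"] by (simp add: gap_after_def)

lemma gap_before_le: "gap_before F \<le> gap_before {}"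
  unfolding gap_before_def by (auto intro: sum_mono2)

lemma flip_out_time:
  assumes D: "D \<in> kco" and F: "F \<subseteq> {..<nv G}" "v < nv G" "v \<notin> F"
    and u: "find_out S D F v = (Some u, t)" and P: "find_path S D {} v u = (Some P, t')"
  shows "call_cost (nv G) D + t + t' + 1 \<le> ods_cost"
  using out_time[OF D F] path_time[OF k_connected_orientation[OF D] F(2), of u "{}"]
    flip_out(4,5)[OF D F u P] u P
  by (simp add: call_cost_def ods_cost_def length_orientation[OF k_connected_orientation[OF D]])

lemma flip_in_time:
  assumes D: "D \<in> kco" and F: "F \<subseteq> {..<nv G}" "v < nv G" "v \<notin> F"
    and u: "find_in S D F v = (Some u, t)" and P: "find_path S D {} u v = (Some P, t')"
  shows "call_cost (nv G) D + t + t' + 1 \<le> ods_cost"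
  using in_time[OF D F] path_time[OF k_connected_orientation[OF D] _ F(2), of u "{}"]
    flip_in(4,5)[OF D F u P] u P
  by (simp add: call_cost_def ods_cost_def length_orientation[OF k_connected_orientation[OF D]])

lemma stop_time:
  assumes D: "D \<in> kco" and F: "F \<subseteq> {..<nv G}" "v < nv G" "v \<notin> F"
    and "find_out S D F v = (r, t) \<or> find_in S D F v = (r, t)"
  shows "call_cost (nv G) D + t + 1 \<le> ods_cost"
  using out_time[OF D F] in_time[OF D F] assms(5)
  by (auto simp: call_cost_def ods_cost_def length_orientation[OF k_connected_orientation[OF D]])

lemma call_cost_less_K: "D \<in> kco \<Longrightarrow> call_cost (nv G) D + 1 \<le> ods_cost"
  by (simp add: call_cost_def ods_cost_def length_orientation[OF k_connected_orientation])

text \<open>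
  The time before the next output is bounded by the calls on the way down to a leaf; the outdegree
  of \<open>v\<close> (for \<open>Reverse_plus\<close>: the degree minus the outdegree) bounds the length of a chain of flips. opods_cost
  call without output contributes at most \<open>ods_cost\<close> to the gap around it.
\<close>

lemma enumeration_gaps:
  assumes B: "gap_after {} + gap_before {} \<le> B"
  shows
  "Reverse_minus (nv G) S D F v tr \<Longrightarrow> D \<in> kco \<Longrightarrow> F \<subseteq> {..<nv G} \<Longrightarrow> v < nv G \<Longrightarrow> v \<notin> F \<Longrightarrow>
    \<forall>a. a + outdeg D v * ods_cost + ods_cost + gap_before (insert v F) \<le> B \<longrightarrow>
      gaps_within B a tr \<and> (rest a tr \<le> a + ods_cost \<or> rest a tr \<le> gap_after F)"
  "Reverse_plus (nv G) S D F v tr \<Longrightarrow> D \<in> kco \<Longrightarrow> F \<subseteq> {..<nv G} \<Longrightarrow> v < nv G \<Longrightarrow> v \<notin> F \<Longrightarrow>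
    \<forall>a. a + (degree v - outdeg D v) * ods_cost + ods_cost + gap_before (insert v F) \<le> B \<longrightarrow>
      gaps_within B a tr \<and> (rest a tr \<le> a + ods_cost \<or> rest a tr \<le> gap_after F)"
  "EnODS' (nv G) S D F tr \<Longrightarrow> D \<in> kco \<Longrightarrow> F \<subseteq> {..<nv G} \<Longrightarrow>
    \<forall>a. a + gap_before F \<le> B \<longrightarrow> gaps_within B a tr \<and> rest a tr \<le> gap_after F"
proof (induction rule: Reverse_minus_Reverse_plus_EnODS'.inducts)
  case (minus_stop D F v t)
  then show ?case using stop_time[OF minus_stop.prems disjI1, OF minus_stop.IH] by simp
next
  case (minus_flip D F v u t P t' tr1 tr2)
  note fl = flip_out[OF minus_flip.prems minus_flip.IH(1,2)]
  note time = flip_out_time[OF minus_flip.prems minus_flip.IH(1,2)]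
  let ?c = "call_cost (nv G) D + t + t'"
  show ?case
  proof (intro allI impI)
    fix a assume "a + outdeg D v * ods_cost + ods_cost + gap_before (insert v F) \<le> B"
    then have a: "a + ods_cost + outdeg (reverse_arcs D (set P)) v * ods_cost + ods_cost + gap_before (insert v F) \<le> B"
      by (simp add: fl(2))
    have 1: "gaps_within B (a + ?c) tr1" "rest (a + ?c) tr1 \<le> a + ?c + ods_cost \<or> rest (a + ?c) tr1 \<le> gap_after F"
      using minus_flip.IH(4)[OF fl(1) minus_flip.prems(2-4), rule_format, of "a + ?c"] a time by auto
    \<comment> \<open>If the time pending after \<open>tr1\<close> is tied to \<open>a\<close>, the
      premise on \<open>a\<close> leaves the room; if it is at most \<open>gap_after F\<close>, the
      condition on \<open>B\<close> does.\<close>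
    have "rest (a + ?c) tr1 + gap_before (insert v F) \<le> B"
      using 1(2) a time B gap_after_le[of F] gap_before_le[of "insert v F"] by linarith
    then have "gaps_within B (rest (a + ?c) tr1) tr2 \<and> rest (rest (a + ?c) tr1) tr2 \<le> gap_after (insert v F)"
      using minus_flip.IH(6)[OF fl(1)] minus_flip.prems(2,3) by simp
    then show "gaps_within B a ([Steps (call_cost (nv G) D), Steps t, Steps t'] @ tr1 @ tr2 @ [Steps 1]) \<and>
      (rest a ([Steps (call_cost (nv G) D), Steps t, Steps t'] @ tr1 @ tr2 @ [Steps 1]) \<le> a + ods_cost \<or>
       rest a ([Steps (call_cost (nv G) D), Steps t, Steps t'] @ tr1 @ tr2 @ [Steps 1]) \<le> gap_after F)"
      using 1(1) gap_after_insert[OF minus_flip.prems(3,4)] by (simp add: add.assoc)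
  qed
next
  case (plus_stop D F v t)
  then show ?case using stop_time[OF plus_stop.prems disjI2, OF plus_stop.IH] by simp
next
  case (plus_flip D F v u t P t' tr1 tr2)
  note fl = flip_in[OF plus_flip.prems plus_flip.IH(1,2)]
  note time = flip_in_time[OF plus_flip.prems plus_flip.IH(1,2)]
  let ?c = "call_cost (nv G) D + t + t'"
  \<comment> \<open>The outdegree after the flip is still at most \<open>degree v\<close>, so the
    truncated difference really drops by one; it bounds the flips still to come.\<close>
  have "degree v - outdeg D v = Suc (degree v - outdeg (reverse_arcs D (set P)) v)"
    using outdeg_le_degree[OF k_connected_orientation[OF fl(1)], of v] fl(2) by simp
  note deg = this
  show ?case
  proof (intro allI impI)
    fix a assume "a + (degree v - outdeg D v) * ods_cost + ods_cost + gap_before (insert v F) \<le> B"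
    then have a: "a + ods_cost + (degree v - outdeg (reverse_arcs D (set P)) v) * ods_cost + ods_cost + gap_before (insert v F) \<le> B"
      by (simp add: deg)
    have 1: "gaps_within B (a + ?c) tr1" "rest (a + ?c) tr1 \<le> a + ?c + ods_cost \<or> rest (a + ?c) tr1 \<le> gap_after F"
      using plus_flip.IH(4)[OF fl(1) plus_flip.prems(2-4), rule_format, of "a + ?c"] a time by auto
    have "rest (a + ?c) tr1 + gap_before (insert v F) \<le> B"
      using 1(2) a time B gap_after_le[of F] gap_before_le[of "insert v F"] by linarith
    then have "gaps_within B (rest (a + ?c) tr1) tr2 \<and> rest (rest (a + ?c) tr1) tr2 \<le> gap_after (insert v F)"
      using plus_flip.IH(6)[OF fl(1)] plus_flip.prems(2,3) by simp
    then show "gaps_within B a ([Steps (call_cost (nv G) D), Steps t, Steps t'] @ tr1 @ tr2 @ [Steps 1]) \<and>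
      (rest a ([Steps (call_cost (nv G) D), Steps t, Steps t'] @ tr1 @ tr2 @ [Steps 1]) \<le> a + ods_cost \<or>
       rest a ([Steps (call_cost (nv G) D), Steps t, Steps t'] @ tr1 @ tr2 @ [Steps 1]) \<le> gap_after F)"
      using 1(1) gap_after_insert[OF plus_flip.prems(3,4)] by (simp add: add.assoc)
  qed
next
  case (ods_step F v D tr1 tr2 tr3)
  note v = Min_unfixed[OF ods_step.IH(1,2)]
  note gap_before = gap_before_insert[OF v] and gap_after = gap_after_insert[OF v]
  have c: "call_cost (nv G) D + 1 \<le> ods_cost" by (rule call_cost_less_K[OF ods_step.prems(1)])
  have deg: "outdeg D v * ods_cost \<le> degree v * ods_cost" "(degree v - outdeg D v) * ods_cost \<le> degree v * ods_cost"
    using outdeg_le_degree[OF k_connected_orientation[OF ods_step.prems(1)]] by (auto intro: mult_le_mono1)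
  show ?case
  proof (intro allI impI)
    fix a assume a: "a + gap_before F \<le> B"
    let ?a = "a + call_cost (nv G) D"
    let ?b = "rest ?a tr1"
    let ?c = "rest ?b tr2"
    have QW: "gap_after F + gap_before F \<le> B" using B gap_after_le[of F] gap_before_le[of F] by linarith
    have "?a + outdeg D v * ods_cost + ods_cost + gap_before (insert v F) \<le> B" using a c deg gap_before by linarith
    then have 1: "gaps_within B ?a tr1" "?b \<le> ?a + ods_cost \<or> ?b \<le> gap_after F"
      using ods_step.IH(4)[OF ods_step.prems v] by auto
    \<comment> \<open>The worst case uses up the three further units: entering this call, a
      \<open>Reverse_minus\<close> without output, and the failed search that ends the chain of
      \<open>Reverse_plus\<close>.\<close>
    have "?b + (degree v - outdeg D v) * ods_cost + ods_cost + gap_before (insert v F) \<le> B"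
      using 1(2) a c deg gap_before QW by linarith
    then have 2: "gaps_within B ?b tr2" "?c \<le> ?b + ods_cost \<or> ?c \<le> gap_after F"
      using ods_step.IH(6)[OF ods_step.prems v] by auto
    have "?c + gap_before (insert v F) \<le> B"
      using 1(2) 2(2) a c gap_before QW by linarith
    then have "gaps_within B ?c tr3 \<and> rest ?c tr3 \<le> gap_after (insert v F)"
      using ods_step.IH(8)[OF ods_step.prems(1)] ods_step.prems(2) v by simp
    then show "gaps_within B a (Steps (call_cost (nv G) D) # tr1 @ tr2 @ tr3 @ [Steps 1]) \<and>
      rest a (Steps (call_cost (nv G) D) # tr1 @ tr2 @ tr3 @ [Steps 1]) \<le> gap_after F"
      using 1(1) 2(1) gap_after by simp
  qed
next
  case (ods_all_fixed F D tr)
  have c: "call_cost (nv G) D + 1 \<le> ods_cost" by (rule call_cost_less_K[OF ods_all_fixed.prems(1)])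
  show ?case
  proof (intro allI impI)
    fix a assume a: "a + gap_before F \<le> B"
    have "a + call_cost (nv G) D + (card ({..<ne G} - {}) + 1) * opods_cost \<le> B"
      using a c by (simp add: gap_before_def)
    moreover have "2 * (ne G + 1) * opods_cost \<le> B"
      using B by (simp add: gap_after_def gap_before_def)
    ultimately have "gaps_within B (a + call_cost (nv G) D) tr \<and>
        rest (a + call_cost (nv G) D) tr \<le> (card ({..<ne G} - {}) + 1) * opods_cost"
      by (rule EnOPODS_gaps[OF ods_all_fixed.IH(2) k_connected_orientation[OF ods_all_fixed.prems(1)]])
    then show "gaps_within B a (Steps (call_cost (nv G) D) # tr @ [Steps 1]) \<and>
      rest a (Steps (call_cost (nv G) D) # tr @ [Steps 1]) \<le> gap_after F"
      by (simp add: gap_after_def)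
  qed
qed

text \<open>
  Every call of \<open>EnODS'\<close> produces at least \<open>z\<close> outputs, which pay for the flippability tests.
\<close>

lemma enumeration_total_time:
  assumes z: "\<And>D. D \<in> kco \<Longrightarrow> z \<le> card (outdeg_class D {})"
  defines "X \<equiv> \<lambda>F. z * ((ne G + 1) * opods_cost) + ods_cost * (3 * card ({..<nv G} - F) + 1)"
  shows
  "Reverse_minus (nv G) S D F v tr \<Longrightarrow> D \<in> kco \<Longrightarrow> F \<subseteq> {..<nv G} \<Longrightarrow> v < nv G \<Longrightarrow> v \<notin> F \<Longrightarrow>
    z * total_time tr \<le> (X (insert v F) + ods_cost) * length (outputs tr) + z * ods_cost"
  "Reverse_plus (nv G) S D F v tr \<Longrightarrow> D \<in> kco \<Longrightarrow> F \<subseteq> {..<nv G} \<Longrightarrow> v < nv G \<Longrightarrow> v \<notin> F \<Longrightarrow>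
    z * total_time tr \<le> (X (insert v F) + ods_cost) * length (outputs tr) + z * ods_cost"
  "EnODS' (nv G) S D F tr \<Longrightarrow> D \<in> kco \<Longrightarrow> F \<subseteq> {..<nv G} \<Longrightarrow>
    z * total_time tr \<le> X F * length (outputs tr) \<and> z \<le> length (outputs tr)"
proof (induction rule: Reverse_minus_Reverse_plus_EnODS'.inducts)
  case (minus_stop D F v t)
  then have "call_cost (nv G) D + t + 1 \<le> ods_cost" by (intro stop_time) auto
  from mult_le_mono2[OF this, of z] show ?case by simp
next
  case (minus_flip D F v u t P t' tr1 tr2)
  note fl = flip_out[OF minus_flip.prems minus_flip.IH(1,2)]
  have "z * (call_cost (nv G) D + t + t' + 1) \<le> z * ods_cost"
    by (rule mult_le_mono2[OF flip_out_time[OF minus_flip.prems minus_flip.IH(1,2)]])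
  moreover have "z * total_time tr1 \<le> (X (insert v F) + ods_cost) * length (outputs tr1) + z * ods_cost"
    using minus_flip.IH(4)[OF fl(1) minus_flip.prems(2-4)] .
  moreover have 2: "z * total_time tr2 \<le> X (insert v F) * length (outputs tr2) \<and> z \<le> length (outputs tr2)"
    using minus_flip.IH(6)[OF fl(1)] minus_flip.prems(2,3) by simp
  \<comment> \<open>The outputs of the inner \<open>EnODS'\<close> pay the amount left open by
    \<open>tr1\<close>; the cost of the present call is left open in its place.\<close>
  moreover have "z * ods_cost \<le> ods_cost * length (outputs tr2)" using 2 by simp
  ultimately have "z * (call_cost (nv G) D + t + t' + 1) + z * total_time tr1 + z * total_time tr2 \<le>
      (X (insert v F) + ods_cost) * (length (outputs tr1) + length (outputs tr2)) + z * ods_cost"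
    unfolding add_mult_distrib add_mult_distrib2 by linarith
  then show ?case by (simp add: algebra_simps)
next
  case (plus_stop D F v t)
  then have "call_cost (nv G) D + t + 1 \<le> ods_cost" by (intro stop_time) auto
  from mult_le_mono2[OF this, of z] show ?case by simp
next
  case (plus_flip D F v u t P t' tr1 tr2)
  note fl = flip_in[OF plus_flip.prems plus_flip.IH(1,2)]
  have "z * (call_cost (nv G) D + t + t' + 1) \<le> z * ods_cost"
    by (rule mult_le_mono2[OF flip_in_time[OF plus_flip.prems plus_flip.IH(1,2)]])
  moreover have "z * total_time tr1 \<le> (X (insert v F) + ods_cost) * length (outputs tr1) + z * ods_cost"
    using plus_flip.IH(4)[OF fl(1) plus_flip.prems(2-4)] .
  moreover have 2: "z * total_time tr2 \<le> X (insert v F) * length (outputs tr2) \<and> z \<le> length (outputs tr2)"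
    using plus_flip.IH(6)[OF fl(1)] plus_flip.prems(2,3) by simp
  moreover have "z * ods_cost \<le> ods_cost * length (outputs tr2)" using 2 by simp
  ultimately have "z * (call_cost (nv G) D + t + t' + 1) + z * total_time tr1 + z * total_time tr2 \<le>
      (X (insert v F) + ods_cost) * (length (outputs tr1) + length (outputs tr2)) + z * ods_cost"
    unfolding add_mult_distrib add_mult_distrib2 by linarith
  then show ?case by (simp add: algebra_simps)
next
  case (ods_step F v D tr1 tr2 tr3)
  note v = Min_unfixed[OF ods_step.IH(1,2)]
  have X: "X F = X (insert v F) + 3 * ods_cost" by (simp add: X_def card_unfixed_insert[OF v] algebra_simps)
  have "z * (call_cost (nv G) D + 1) \<le> z * ods_cost"
    by (rule mult_le_mono2[OF call_cost_less_K[OF ods_step.prems(1)]])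
  moreover have "z * total_time tr1 \<le> (X (insert v F) + ods_cost) * length (outputs tr1) + z * ods_cost"
    using ods_step.IH(4)[OF ods_step.prems v] .
  moreover have "z * total_time tr2 \<le> (X (insert v F) + ods_cost) * length (outputs tr2) + z * ods_cost"
    using ods_step.IH(6)[OF ods_step.prems v] .
  moreover have 3: "z * total_time tr3 \<le> X (insert v F) * length (outputs tr3) \<and> z \<le> length (outputs tr3)"
    using ods_step.IH(8)[OF ods_step.prems(1)] ods_step.prems(2) v by simp
  \<comment> \<open>This pays three amounts: the present call and what each of the two
    \<open>Reverse\<close> calls leaves open. Hence the coefficient 3 per free vertex in
    \<open>X\<close>.\<close>
  moreover have "z * ods_cost \<le> ods_cost * length (outputs tr3)" using 3 by simp
  ultimately have "z * (call_cost (nv G) D + 1) + z * total_time tr1 + z * total_time tr2 + z * total_time tr3 \<le>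
      X F * (length (outputs tr1) + length (outputs tr2) + length (outputs tr3))"
    unfolding X add_mult_distrib add_mult_distrib2 by linarith
  then show ?case using 3 by (simp add: algebra_simps)
next
  case (ods_all_fixed F D tr)
  have O: "D \<in> orientations G" by (rule k_connected_orientation[OF ods_all_fixed.prems(1)])
  have out: "distinct (outputs tr)" "set (outputs tr) = outdeg_class D {}"
    using EnOPODS_outputs[OF ods_all_fixed.IH(2) O] by auto
  then have zl: "z \<le> length (outputs tr)"
    using z[OF ods_all_fixed.prems(1)] by (metis distinct_card)
  have "total_time tr \<le> (ne G + 1) * opods_cost * length (outputs tr)"
    using EnOPODS_total_time[OF ods_all_fixed.IH(2) O] by simp
  from mult_le_mono2[OF this, of z]
  have "z * total_time tr \<le> z * ((ne G + 1) * opods_cost) * length (outputs tr)" by (simp only: mult.assoc)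
  moreover have "z * (call_cost (nv G) D + 1) \<le> z * ods_cost"
    by (rule mult_le_mono2[OF call_cost_less_K[OF ods_all_fixed.prems(1)]])
  moreover have "z * ods_cost \<le> ods_cost * length (outputs tr)" using zl by simp
  moreover have "(z * ((ne G + 1) * opods_cost) + ods_cost) * length (outputs tr) \<le> X F * length (outputs tr)"
    unfolding X_def by (intro mult_le_mono1) simp
  ultimately have "z * (call_cost (nv G) D + 1) + z * total_time tr \<le> X F * length (outputs tr)"
    unfolding add_mult_distrib by linarith
  then show ?case using zl by (simp add: algebra_simps)
qed

lemma algorithm4_delay:
  assumes "correct_start G k (r, t)" "algorithm4 G S (r, t) tr"
  shows "delay tr \<le> t + gap_after {} + gap_before {}"
  using assms(2)
proof cases
  case infeasible
  then show ?thesis by (intro delay_leI) auto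
next
  case (feasible D tr')
  then have "D \<in> kco" using assms by (simp add: correct_start_def finds_Some)
  then have "gaps_within (t + gap_after {} + gap_before {}) t tr' \<and> rest t tr' \<le> gap_after {}"
    using enumeration_gaps(3)[OF _ feasible(3), of "t + gap_after {} + gap_before {}"] by simp
  then show ?thesis using feasible by (intro delay_leI) auto
qed

lemma algorithm4_total_time:
  assumes "correct_start G k (r, t)" "algorithm4 G S (r, t) tr" "kco \<noteq> {}"
    and z: "\<And>D. D \<in> kco \<Longrightarrow> z \<le> card (outdeg_class D {})"
  shows "z * total_time tr \<le> z * t +
      (z * ((ne G + 1) * opods_cost) + ods_cost * (3 * nv G + 1)) * length (outputs tr)" (is ?T)
    and "z \<le> length (outputs tr)"
proof -
  from assms(2) have "?T \<and> z \<le> length (outputs tr)"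
  proof cases
    case infeasible
    then show ?thesis using assms(1,3) by (auto simp: correct_start_def finds_None)
  next
    case (feasible D tr')
    then have "D \<in> kco" using assms by (simp add: correct_start_def finds_Some)
    then show ?thesis
      using enumeration_total_time(3)[OF z feasible(3)] feasible(2) by (simp add: add_mult_distrib2)
  qed
  then show ?T "z \<le> length (outputs tr)" by auto
qed

end

section \<open>Standard subroutines\<close>

lemma build_adj_correct:
  "length (fst (build_adj D F es adj)) = length adj"
  "x < length adj \<Longrightarrow>
    fst (build_adj D F es adj) ! x = rev (filter (\<lambda>e. e \<notin> F \<and> fst (D ! e) = x) es) @ adj ! x"
  "snd (build_adj D F es adj) = length es + 1"
  by (induction D F es adj rule: build_adj.induct) (auto simp: Let_def nth_list_update split: prod.splits)

lemma cas_snoc: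
  "pre_digraph.cas H s (p @ [e]) t \<longleftrightarrow> pre_digraph.cas H s p (tail H e) \<and> t = head H e"
  by (induction p arbitrary: s) (auto simp: pre_digraph.cas.simps)

lemma first_such_correct:
  shows "finds (fst (first_such test us)) (\<lambda>u. u \<in> set us \<and> fst (test u))"
    and "(\<And>u. u \<in> set us \<Longrightarrow> snd (test u) \<le> T) \<Longrightarrow> snd (first_such test us) \<le> length us * (T + 1) + 1"
proof (induction us)
  case (Cons u us)
  {
    case 1
    then show ?case
      using Cons.IH(1) by (auto simp: finds_def Let_def split: prod.splits option.splits)
  next
    case 2
    then have "snd (test u) \<le> T" "snd (first_such test us) \<le> length us * (T + 1) + 1"
      using Cons.IH(2) by auto
    then show ?case by (auto simp: Let_def split: prod.splits)
  }
qed (auto simp: finds_def)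

section \<open>Depth-first search and the flippability test\<close>

context multigraph begin

definition adjacency :: "orientation \<Rightarrow> nat set \<Rightarrow> nat list list \<Rightarrow> bool" where
  "adjacency D F adj \<longleftrightarrow> length adj = nv G \<and>
     (\<forall>x<nv G. set (adj ! x) = {e. e < ne G \<and> e \<notin> F \<and> fst (D ! e) = x})"

text \<open>The tails on the stored path are distinct and visited. As the goal stays unvisited, the
  path is simple when it arrives there, and its length is at most the number of vertices.\<close>

definition stack_entry :: "orientation \<Rightarrow> nat set \<Rightarrow> nat \<Rightarrow> bool list \<Rightarrow> nat \<times> nat list \<Rightarrow> bool" where
  "stack_entry D F s un = (\<lambda>(x, p). x < nv G \<and> set p \<subseteq> {..<ne G} - F \<and>
     pre_digraph.cas (digraph_of (nv G) D F) s (rev p) x \<and> distinct (map (\<lambda>e. fst (D ! e)) p) \<and>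
     (\<forall>e\<in>set p. \<not> un ! fst (D ! e)))"

lemma stack_entry_visit:
  assumes D: "D \<in> orientations G" and x: "stack_entry D F s un (x, p)" "un ! x" "length un = nv G"
    and e: "e < ne G" "e \<notin> F" "fst (D ! e) = x"
  shows "stack_entry D F s (un[x := False]) (snd (D ! e), e # p)"
proof -
  have "x \<notin> fst ` (!) D ` set p" using x(1,2) by (auto simp: stack_entry_def)
  then show ?thesis
    using x e orientation_arc(2)[OF D e(1)]
    by (auto simp: stack_entry_def cas_snoc nth_list_update image_image)
qed

text \<open>The invariant says that an arc leaving the visited set leads to a vertex on the stack.
  With an empty stack the visited set is closed and separates \<open>s\<close> from the goal. For
  the time, visiting \<open>x\<close> scans its list once and pushes as many entries, each popped
  later; this explains the coefficient 2. The summand \<open>nv G\<close> is for reversing the path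
  found.\<close>

lemma dfs_correct:
  assumes D: "D \<in> orientations G" and adj: "adjacency D F adj" and st: "s < nv G" "s \<noteq> goal" "goal < nv G"
    and "length un = nv G" "un ! goal" "\<forall>a\<in>set stk. stack_entry D F s un a"
    and "\<not> un ! s \<or> s \<in> fst ` set stk"
    and "\<forall>e<ne G. e \<notin> F \<longrightarrow> \<not> un ! fst (D ! e) \<longrightarrow> \<not> un ! snd (D ! e) \<or> snd (D ! e) \<in> fst ` set stk"
  shows "finds (fst (dfs D adj goal un stk)) (\<lambda>P. pre_digraph.apath (digraph_of (nv G) D F) s P goal) \<and>
    snd (dfs D adj goal un stk) \<le>
      length stk + (\<Sum>x\<in>{x. x < nv G \<and> un ! x}. 2 * length (adj ! x) + 1) + nv G + 1"
  using assms
proof (induction D adj goal un stk rule: dfs.induct)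
  case (1 D adj goal un)
  note D = "1.prems"(1)
  have "\<nexists>P. pre_digraph.apath (digraph_of (nv G) D F) s P goal"
  proof
    assume "\<exists>P. pre_digraph.apath (digraph_of (nv G) D F) s P goal"
    then obtain P where P: "pre_digraph.apath (digraph_of (nv G) D F) s P goal" by blast
    note P' = apath_arcs[OF D P]
    obtain e where e: "e \<in> set P" "fst (D ! e) \<in> {x. \<not> un ! x}" "snd (D ! e) \<notin> {x. \<not> un ! x}"
      using cas_crosses[OF P'(3), of "{x. \<not> un ! x}"] "1.prems" by auto
    then have "e < ne G" "e \<notin> F" using P'(1) by auto
    then show False using "1.prems"(10) e by auto
  qed
  then show ?case by (simp add: finds_None)
next
  case (2 D adj goal un x p stk)
  note D = "2.prems"(1) and adj = "2.prems"(2)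
  have entry: "stack_entry D F s un (x, p)" using "2.prems"(8) by simp
  show ?case
  proof (cases "x = goal")
    case True
    interpret fin_digraph "digraph_of (nv G) D F" by (rule fin_digraph_orientation[OF D])
    have p: "set p \<subseteq> {..<ne G} - F" "cas s (rev p) goal" "distinct (map (\<lambda>e. fst (D ! e)) p)"
      "\<forall>e\<in>set p. \<not> un ! fst (D ! e)"
      using entry True by (auto simp: stack_entry_def)
    have "p \<noteq> []" using p(2) "2.prems"(4) by auto
    then have verts: "awalk_verts s (rev p) = map (\<lambda>e. fst (D ! e)) (rev p) @ [goal]"
      using p(2) awlast_if_cas[OF p(2)] by (simp add: awalk_verts_conv)
    have "apath s (rev p) goal"
      unfolding apath_def awalk_def verts
      using p "2.prems"(3,7) length_orientation[OF D] by (auto simp: rev_map[symmetric])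
    moreover have "length p \<le> nv G"
    proof -
      have "set (map (\<lambda>e. fst (D ! e)) p) \<subseteq> {..<nv G}" using p(1) orientation_arc(1)[OF D] by auto
      from card_mono[OF _ this] show ?thesis using distinct_card[OF p(3)] by simp
    qed
    ultimately show ?thesis using True by (simp add: finds_Some)
  next
    case not_goal: False
    have x: "x < nv G" using entry by (simp add: stack_entry_def)
    show ?thesis
    proof (cases "un ! x")
      case True
      let ?un = "un[x := False]"
      let ?stk = "map (\<lambda>e. (snd (D ! e), e # p)) (adj ! x) @ stk"
      have cond: "x < length un \<and> un ! x" using x True "2.prems"(6) by simp
      have adjx: "set (adj ! x) = {e. e < ne G \<and> e \<notin> F \<and> fst (D ! e) = x}"
        using adj x by (simp add: adjacency_def)
      have un_mono: "\<not> un ! y \<Longrightarrow> \<not> ?un ! y" for y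
        by (metis list_update_beyond linorder_not_less nth_list_update)
      have stk: "stack_entry D F s ?un a" if "a \<in> set stk" for a
        using "2.prems"(8) that un_mono by (auto simp: stack_entry_def split: prod.splits)
      have new: "stack_entry D F s ?un (snd (D ! e), e # p)" if "e \<in> set (adj ! x)" for e
        using stack_entry_visit[OF D entry True "2.prems"(6), of e] that by (simp add: adjx)
      have IH: "finds (fst (dfs D adj goal ?un ?stk)) (\<lambda>P. pre_digraph.apath (digraph_of (nv G) D F) s P goal) \<and>
        snd (dfs D adj goal ?un ?stk) \<le>
          length ?stk + (\<Sum>x\<in>{y. y < nv G \<and> ?un ! y}. 2 * length (adj ! x) + 1) + nv G + 1"
      proof (rule "2.IH"(1)[OF not_goal cond D adj "2.prems"(3-5)])
        show "length ?un = nv G" using "2.prems"(6) by simp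
        show "?un ! goal" using not_goal "2.prems"(7) by simp
        show "\<forall>a\<in>set ?stk. stack_entry D F s ?un a" using stk new by auto
        show "\<not> ?un ! s \<or> s \<in> fst ` set ?stk"
        proof (cases "s = x")
          case True
          then show ?thesis using cond by simp
        next
          case False
          then show ?thesis using "2.prems"(9) un_mono[of s] by auto
        qed
        show "\<forall>e<ne G. e \<notin> F \<longrightarrow> \<not> ?un ! fst (D ! e) \<longrightarrow>
          \<not> ?un ! snd (D ! e) \<or> snd (D ! e) \<in> fst ` set ?stk"
        proof (intro allI impI)
          fix e assume e: "e < ne G" "e \<notin> F" "\<not> ?un ! fst (D ! e)"
          show "\<not> ?un ! snd (D ! e) \<or> snd (D ! e) \<in> fst ` set ?stk"
          proof (cases "fst (D ! e) = x")
            case True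
            then have "e \<in> set (adj ! x)" using e by (simp add: adjx)
            then have "snd (D ! e) \<in> fst ` set ?stk" by (force simp: image_iff)
            then show ?thesis by blast
          next
            case False
            then have "\<not> un ! fst (D ! e)" using e(3) by simp
            then have "\<not> un ! snd (D ! e) \<or> snd (D ! e) = x \<or> snd (D ! e) \<in> fst ` set stk"
              using "2.prems"(10) e(1,2) by auto
            then show ?thesis using un_mono[of "snd (D ! e)"] cond by (auto simp: image_Un)
          qed
        qed
      qed
      have "{y. y < nv G \<and> un ! y} = insert x {y. y < nv G \<and> ?un ! y}"
        using x True "2.prems"(6) by (auto simp: nth_list_update)
      moreover have "x \<notin> {y. y < nv G \<and> ?un ! y}" using cond by simp
      ultimately have "(\<Sum>x\<in>{y. y < nv G \<and> un ! y}. 2 * length (adj ! x) + 1) =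
          2 * length (adj ! x) + 1 + (\<Sum>x\<in>{y. y < nv G \<and> ?un ! y}. 2 * length (adj ! x) + 1)"
        by simp
      moreover obtain r t where "dfs D adj goal ?un ?stk = (r, t)" by fastforce
      ultimately show ?thesis
        using IH not_goal cond by (simp add: Let_def)
    next
      case False
      have nc: "\<not> (x < length un \<and> un ! x)" using False by simp
      have IH: "finds (fst (dfs D adj goal un stk)) (\<lambda>P. pre_digraph.apath (digraph_of (nv G) D F) s P goal) \<and>
        snd (dfs D adj goal un stk) \<le>
          length stk + (\<Sum>x\<in>{x. x < nv G \<and> un ! x}. 2 * length (adj ! x) + 1) + nv G + 1"
      proof (rule "2.IH"(2)[OF not_goal nc D adj "2.prems"(3-7)])
        show "\<forall>a\<in>set stk. stack_entry D F s un a" using "2.prems"(8) by simp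
        show "\<not> un ! s \<or> s \<in> fst ` set stk" using "2.prems"(9) False by auto
        show "\<forall>e<ne G. e \<notin> F \<longrightarrow> \<not> un ! fst (D ! e) \<longrightarrow>
          \<not> un ! snd (D ! e) \<or> snd (D ! e) \<in> fst ` set stk"
          using "2.prems"(10) False by auto
      qed
      moreover obtain r t where "dfs D adj goal un stk = (r, t)" by fastforce
      ultimately show ?thesis using not_goal nc by (auto simp: Let_def)
    qed
  qed
qed

text \<open>With n vertices and m edges, the arrays take 2 n, the adjacency lists m + 1 and the
  search at most 2 m + 2 n + 2 steps; n \<ge> 1 absorbs the additive constants.\<close>

lemma std_path_correct:
  assumes D: "D \<in> orientations G" and st: "s < nv G" "t < nv G" "s \<noteq> t"
  shows "finds (fst (std_path (nv G) D F s t)) (\<lambda>P. pre_digraph.apath (digraph_of (nv G) D F) s P t)"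
    and "snd (std_path (nv G) D F s t) \<le> 7 * (nv G + ne G)"
proof -
  obtain adj t1 where adj: "build_adj D F [0..<length D] (replicate (nv G) []) = (adj, t1)" by fastforce
  note b = build_adj_correct[where D = D and F = F and es = "[0..<length D]"
      and adj = "replicate (nv G) []", unfolded adj fst_conv snd_conv]
  have t1: "t1 = ne G + 1" using b(3) by (simp add: length_orientation[OF D])
  have nth_adj: "adj ! x = rev (filter (\<lambda>e. e \<notin> F \<and> fst (D ! e) = x) [0..<ne G])" if "x < nv G" for x
    using b(2)[of x] that by (simp add: length_orientation[OF D])
  have "adjacency D F adj"
    using b(1) by (auto simp: adjacency_def nth_adj)
  have un: "replicate (nv G) True ! x" if "x < nv G" for x using that by simp
  have "finds (fst (dfs D adj t (replicate (nv G) True) [(s, [])]))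
        (\<lambda>P. pre_digraph.apath (digraph_of (nv G) D F) s P t) \<and>
      snd (dfs D adj t (replicate (nv G) True) [(s, [])]) \<le>
        length [(s, [] :: nat list)] +
        (\<Sum>x\<in>{x. x < nv G \<and> replicate (nv G) True ! x}. 2 * length (adj ! x) + 1) + nv G + 1"
    using st un orientation_arc(1)[OF D]
    by (intro dfs_correct[OF D \<open>adjacency D F adj\<close>]) 
      (auto simp: stack_entry_def pre_digraph.cas.simps)
  moreover have "(\<Sum>x\<in>{x. x < nv G \<and> replicate (nv G) True ! x}. 2 * length (adj ! x) + 1) \<le> 2 * ne G + nv G"
  proof -
    have len: "length (adj ! x) \<le> outdeg D x" if "x < nv G" for x
    proof -
      have "length (adj ! x) = card {e. e < ne G \<and> e \<notin> F \<and> fst (D ! e) = x}"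
        unfolding nth_adj[OF that] by (simp add: length_filter_conv_card cong: conj_cong)
      also have "\<dots> \<le> outdeg D x"
        unfolding outdeg_def by (rule card_mono) (auto simp: length_orientation[OF D])
      finally show ?thesis .
    qed
    have "{x. x < nv G \<and> replicate (nv G) True ! x} = {..<nv G}" using un by auto
    then have "(\<Sum>x\<in>{x. x < nv G \<and> replicate (nv G) True ! x}. 2 * length (adj ! x) + 1) \<le>
        (\<Sum>x<nv G. 2 * outdeg D x + 1)"
      using len by (simp only:) (intro sum_mono, simp)
    also have "\<dots> = 2 * ne G + nv G"
      unfolding sum.distrib by (simp add: sum_outdeg_orientation[OF D] flip: sum_distrib_left)
    finally show ?thesis .
  qed
  ultimately show "finds (fst (std_path (nv G) D F s t)) (\<lambda>P. pre_digraph.apath (digraph_of (nv G) D F) s P t)"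
    and "snd (std_path (nv G) D F s t) \<le> 7 * (nv G + ne G)"
    using st(1) t1 by (auto simp: std_path_def adj split: prod.splits)
qed

text \<open>Each reversal lowers all cuts separating \<open>u\<close> from \<open>v\<close> by
  exactly one, so \<open>j\<close> rounds succeed iff these cuts are at least \<open>j\<close>,
  whichever paths are taken.\<close>

lemma std_augment_correct:
  assumes "D \<in> orientations G" and uv: "u < nv G" "v < nv G" "u \<noteq> v"
  shows "(fst (std_augment j (nv G) D u v) \<longleftrightarrow>
      (\<forall>X \<subseteq> {..<nv G}. u \<in> X \<longrightarrow> v \<notin> X \<longrightarrow> j \<le> cut_size G D X)) \<and>
    snd (std_augment j (nv G) D u v) \<le> j * (9 * (nv G + ne G)) + 1"
  using assms(1)
proof (induction j arbitrary: D)
  case 0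
  then show ?case by simp
next
  case (Suc j)
  note D = Suc.prems
  note path = std_path_correct[OF D uv, of "{}"]
  obtain r t where r: "std_path (nv G) D {} u v = (r, t)" by fastforce
  then have t: "t \<le> 7 * (nv G + ne G)" using path(2) by simp
  show ?case
  proof (cases r)
    case None
    have "\<not> (\<forall>X \<subseteq> {..<nv G}. u \<in> X \<longrightarrow> v \<notin> X \<longrightarrow> Suc j \<le> cut_size G D X)"
    proof
      assume *: "\<forall>X \<subseteq> {..<nv G}. u \<in> X \<longrightarrow> v \<notin> X \<longrightarrow> Suc j \<le> cut_size G D X"
      \<comment> \<open>With threshold 0, flippability only says that the separating cuts are
        positive; this already yields a path and contradicts the failed search.\<close>
      have "flippable 0 (digraph_of (nv G) D {}) u v"
        unfolding flippable_iff[OF D]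
      proof (intro conjI allI impI)
        fix X assume "X \<subseteq> {..<nv G}" "u \<in> X" "v \<notin> X"
        then have "Suc j \<le> cut_size G D X" using * by blast
        then show "0 < cut_size G D X" by simp
      qed (use uv in auto)
      from flippable_imp_apath[OF D this] show False using path(1) r None by (simp add: finds_None)
    qed
    then have "fst (std_augment (Suc j) (nv G) D u v) \<longleftrightarrow>
        (\<forall>X \<subseteq> {..<nv G}. u \<in> X \<longrightarrow> v \<notin> X \<longrightarrow> Suc j \<le> cut_size G D X)"
      unfolding std_augment.simps r None by simp
    then show ?thesis using r None t uv(1) by simp
  next
    case (Some P)
    have P: "pre_digraph.apath (digraph_of (nv G) D {}) u P v" using path(1) r Some by (simp add: finds_Some)
    note IH = Suc.IH[OF reverse_orientation[OF D, of "set P"]]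
    have "j \<le> cut_size G (reverse_arcs D (set P)) X \<longleftrightarrow> Suc j \<le> cut_size G D X"
      if "X \<subseteq> {..<nv G}" "u \<in> X" "v \<notin> X" for X
      using cut_reverse_path[OF D P _ that(2,3)] finite_subset[OF that(1)] by auto
    then have "(\<forall>X \<subseteq> {..<nv G}. u \<in> X \<longrightarrow> v \<notin> X \<longrightarrow> j \<le> cut_size G (reverse_arcs D (set P)) X) \<longleftrightarrow>
        (\<forall>X \<subseteq> {..<nv G}. u \<in> X \<longrightarrow> v \<notin> X \<longrightarrow> Suc j \<le> cut_size G D X)" by blast
    then show ?thesis
      using IH r Some t uv(1) by (auto simp: length_orientation[OF D] split: prod.splits)
  qed
qed

lemma std_augment_flippable:
  assumes "D \<in> orientations G" "u < nv G" "v < nv G" "u \<noteq> v"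
  shows "fst (std_augment (k + 1) (nv G) D u v) \<longleftrightarrow> flippable k (digraph_of (nv G) D {}) u v"
    and "snd (std_augment (k + 1) (nv G) D u v) \<le> (k + 1) * (9 * (nv G + ne G)) + 1"
  using std_augment_correct[OF assms, of "k + 1"] assms
  by (simp_all add: flippable_iff Suc_le_eq)

text \<open>With \<open>z\<close> as in the proof, each tested vertex costs at most
  \<open>9 * z + 2\<close>, hence at most \<open>11 * z\<close>; collecting the candidates and the
  final step fit into a further \<open>2 * (nv G * z)\<close>.\<close>

lemma std_find_correct:
  assumes "\<And>u. u < nv G \<Longrightarrow> u \<noteq> v \<Longrightarrow> fst (test u) \<longleftrightarrow> P u"
    and time: "\<And>u. u < nv G \<Longrightarrow> u \<noteq> v \<Longrightarrow> snd (test u) \<le> (k + 1) * (9 * (nv G + ne G)) + 1"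
    and v: "v < nv G"
  shows "finds (fst (std_find (nv G) test F v)) (\<lambda>u. u \<in> {..<nv G} - F \<and> u \<noteq> v \<and> P u)"
    and "snd (std_find (nv G) test F v) \<le> 13 * ((k + 1) * nv G * (nv G + ne G))"
proof -
  let ?us = "filter (\<lambda>u. u \<notin> F \<and> u \<noteq> v) [0..<nv G]"
  have "u \<in> set ?us \<and> fst (test u) \<longleftrightarrow> u \<in> {..<nv G} - F \<and> u \<noteq> v \<and> P u" for u
    using assms(1)[of u] by auto
  then show "finds (fst (std_find (nv G) test F v)) (\<lambda>u. u \<in> {..<nv G} - F \<and> u \<noteq> v \<and> P u)"
    using first_such_correct(1)[of test ?us] by (simp add: std_find_def case_prod_beta)
  define z where "z = (k + 1) * (nv G + ne G)"
  have z: "1 \<le> z" "9 * z = (k + 1) * (9 * (nv G + ne G))" using v by (auto simp: z_def)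
  have "snd (std_find (nv G) test F v) \<le> nv G + (length ?us * (9 * z + 1 + 1) + 1)"
    using first_such_correct(2)[of ?us test "9 * z + 1"] time by (auto simp: std_find_def z(2) case_prod_beta)
  also have "length ?us \<le> nv G" by (metis diff_zero length_filter_le length_upt)
  then have "nv G + (length ?us * (9 * z + 1 + 1) + 1) \<le> nv G + (nv G * (9 * z + 1 + 1) + 1)"
    by (intro add_mono mult_le_mono1 order_refl)
  also have "nv G * (9 * z + 1 + 1) \<le> nv G * (11 * z)" using z(1) by (intro mult_le_mono2) linarith
  also have "nv G + (nv G * (11 * z) + 1) \<le> 13 * (nv G * z)"
  proof -
    have "nv G \<le> nv G * z" "nv G * (11 * z) = 11 * (nv G * z)" using z(1) by simp_all
    then show ?thesis using v by linarith
  qed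
  also have "\<dots> = 13 * ((k + 1) * nv G * (nv G + ne G))" by (simp only: z_def mult_ac)
  finally show "snd (std_find (nv G) test F v) \<le> 13 * ((k + 1) * nv G * (nv G + ne G))" by simp
qed

text \<open>Shows that the assumptions on subroutines are met by a concrete implementation, with one
  constant for all graphs and all \<open>k\<close>.\<close>

lemma std_subroutines_correct:
  "correct_subroutines G k (std_subroutines G k)"
  "subroutines_within 13 G k (std_subroutines G k)"
proof -
  have out: "finds (fst (find_out (std_subroutines G k) D F v))
        (\<lambda>u. u \<in> {..<nv G} - F \<and> u \<noteq> v \<and> flippable k (digraph_of (nv G) D {}) v u)"
      "snd (find_out (std_subroutines G k) D F v) \<le> 13 * ((k + 1) * nv G * (nv G + ne G))"
    and inn: "finds (fst (find_in (std_subroutines G k) D F v))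
        (\<lambda>u. u \<in> {..<nv G} - F \<and> u \<noteq> v \<and> flippable k (digraph_of (nv G) D {}) u v)"
      "snd (find_in (std_subroutines G k) D F v) \<le> 13 * ((k + 1) * nv G * (nv G + ne G))"
    if "D \<in> k_connected_orientations G k" "v < nv G" for D F v
  proof -
    have D: "D \<in> orientations G" by (rule k_connected_orientation[OF that(1)])
    note o = std_find_correct[of v "\<lambda>u. std_augment (k + 1) (nv G) D v u"
        "\<lambda>u. flippable k (digraph_of (nv G) D {}) v u" k F,
        OF std_augment_flippable(1)[OF D that(2)] std_augment_flippable(2)[OF D that(2)] that(2)]
    note i = std_find_correct[of v "\<lambda>u. std_augment (k + 1) (nv G) D u v"
        "\<lambda>u. flippable k (digraph_of (nv G) D {}) u v" k F,
        OF std_augment_flippable(1)[OF D _ that(2)] std_augment_flippable(2)[OF D _ that(2)] that(2)]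
    show "finds (fst (find_out (std_subroutines G k) D F v))
        (\<lambda>u. u \<in> {..<nv G} - F \<and> u \<noteq> v \<and> flippable k (digraph_of (nv G) D {}) v u)"
      "snd (find_out (std_subroutines G k) D F v) \<le> 13 * ((k + 1) * nv G * (nv G + ne G))"
      using o by (auto simp: std_subroutines_def)
    show "finds (fst (find_in (std_subroutines G k) D F v))
        (\<lambda>u. u \<in> {..<nv G} - F \<and> u \<noteq> v \<and> flippable k (digraph_of (nv G) D {}) u v)"
      "snd (find_in (std_subroutines G k) D F v) \<le> 13 * ((k + 1) * nv G * (nv G + ne G))"
      using i by (auto simp: std_subroutines_def)
  qed
  have path: "finds (fst (find_path (std_subroutines G k) D F s t))
      (\<lambda>P. pre_digraph.apath (digraph_of (nv G) D F) s P t)"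
    "snd (find_path (std_subroutines G k) D F s t) \<le> 13 * (nv G + ne G)"
    if "D \<in> orientations G" "s < nv G" "t < nv G" "s \<noteq> t" for D F s t
    using std_path_correct[OF that, of F] by (simp_all add: std_subroutines_def)
  show "correct_subroutines G k (std_subroutines G k)"
    unfolding correct_subroutines_def using out(1) inn(1) path(1) by simp
  show "subroutines_within 13 G k (std_subroutines G k)"
    unfolding subroutines_within_def using out(2) inn(2) path(2) by simp
qed

end

section \<open>Delay and amortized time\<close>

text \<open>The search for an initial orientation fits into the delay: under k n \<le> m, two of the
  three factors k n in k^3 n^3 are replaced by m.\<close>

lemma start_steps_le:
  fixes k n m :: nat
  assumes "k * n \<le> m" "1 \<le> k"
  shows "k ^ 3 * n ^ 3 + k * n ^ 2 * m \<le> 2 * (k * n * m ^ 2)"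
proof -
  have "n \<le> m" using assms mult_le_mono1[of 1 k n] by linarith
  have "k ^ 3 * n ^ 3 = k * n * ((k * n) * (k * n))" by (simp add: power3_eq_cube mult_ac)
  also have "\<dots> \<le> k * n * (m * m)" using assms(1) by (intro mult_le_mono le_refl)
  finally have "k ^ 3 * n ^ 3 \<le> k * n * m ^ 2" by (simp only: power2_eq_square)
  moreover have "k * n ^ 2 * m \<le> k * n * m ^ 2"
  proof -
    have "k * n ^ 2 * m = k * n * (n * m)" by (simp add: power2_eq_square mult_ac)
    also have "\<dots> \<le> k * n * (m * m)" using \<open>n \<le> m\<close> by (intro mult_le_mono le_refl)
    finally show ?thesis by (simp only: power2_eq_square)
  qed
  ultimately show ?thesis by linarith
qed

text \<open>\<open>kn_le\<close> follows if a \<open>k\<close>-connected orientation exists.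
  Assuming it instead of feasibility also covers infeasible graphs with enough edges.\<close>

locale bounded_enumeration =
  timed_enumeration G k S "c * (nv G + ne G)" "c * ((k + 1) * nv G * (nv G + ne G))" for G k S c +
  assumes nv2: "2 \<le> nv G" and k1: "1 \<le> k" and kn_le: "k * nv G \<le> ne G"
begin

lemma nv_le_ne: "nv G \<le> ne G"
  using kn_le k1 mult_le_mono1[of 1 k "nv G"] by linarith

lemma opods_cost_le: "opods_cost \<le> (2 * c + 3) * ne G"
proof -
  have "c * (nv G + ne G) \<le> c * (2 * ne G)" using nv_le_ne by (intro mult_le_mono2) simp
  then have "opods_cost \<le> c * (2 * ne G) + 3 * ne G" unfolding opods_cost_def using nv_le_ne nv2 by linarith
  then show ?thesis by (simp add: algebra_simps)
qed

lemma ods_cost_le: "ods_cost \<le> (6 * c + 4) * (k * nv G * ne G)"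
proof -
  have m: "ne G \<le> k * nv G * ne G" using k1 nv2 by simp
  have "c * (nv G + ne G) \<le> c * (2 * (k * nv G * ne G))"
    using nv_le_ne m by (intro mult_le_mono2) linarith
  moreover have "c * ((k + 1) * nv G * (nv G + ne G)) \<le> c * ((2 * k) * nv G * (2 * ne G))"
    using nv_le_ne k1 by (intro mult_le_mono le_refl) simp_all
  moreover have "nv G + ne G + 3 \<le> 4 * (k * nv G * ne G)"
    using nv_le_ne m nv2 by linarith
  ultimately have "ods_cost \<le> c * (2 * (k * nv G * ne G)) + c * ((2 * k) * nv G * (2 * ne G)) + 4 * (k * nv G * ne G)"
    unfolding ods_cost_def by linarith
  then show ?thesis by (simp add: algebra_simps)
qed

lemma EnOPODS_cost_le: "(ne G + 1) * opods_cost \<le> (4 * c + 6) * ne G ^ 2"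
proof -
  have "(ne G + 1) * opods_cost \<le> (2 * ne G) * ((2 * c + 3) * ne G)"
    using nv_le_ne nv2 opods_cost_le by (intro mult_le_mono) auto
  also have "\<dots> = (4 * c + 6) * ne G ^ 2" by (simp add: power2_eq_square algebra_simps)
  finally show ?thesis .
qed

lemma ne2_le: "ne G ^ 2 \<le> k * nv G * ne G ^ 2"
  using k1 nv2 by simp

lemma delay_le:
  assumes "correct_start G k (r, t)" "algorithm4 G S (r, t) tr"
    and t: "t \<le> c * (k ^ 3 * nv G ^ 3 + k * nv G ^ 2 * ne G)"
  shows "delay tr \<le> (46 * c + 38) * (k * nv G * ne G ^ 2)"
proof -
  define N where "N = k * nv G * ne G ^ 2"
  have "t \<le> c * (2 * N)"
    unfolding N_def by (rule order_trans[OF t mult_le_mono2[OF start_steps_le[OF kn_le k1]]])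
  then have t': "t \<le> 2 * (c * N)" by simp
  have opods_cost: "(ne G + 1) * opods_cost \<le> 4 * (c * N) + 6 * N"
  proof -
    have "(ne G + 1) * opods_cost \<le> (4 * c + 6) * N"
      unfolding N_def by (rule order_trans[OF EnOPODS_cost_le mult_le_mono2[OF ne2_le]])
    then show ?thesis by (simp add: algebra_simps)
  qed
  have "(\<Sum>v\<in>{..<nv G} - {}. degree v * ods_cost + 3 * ods_cost) = 2 * ne G * ods_cost + 3 * nv G * ods_cost"
    unfolding sum.distrib Diff_empty sum_distrib_right[symmetric] sum_degree by simp
  then have gap_before: "gap_before {} = (ne G + 1) * opods_cost + (1 + 2 * ne G + 3 * nv G) * ods_cost"
    by (simp only: gap_before_def) (simp add: algebra_simps)
  \<comment> \<open>The degree sum \<open>2 * ne G\<close> keeps the number of calls before an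
    output linear in the number of edges; bounding each degree by \<open>ne G\<close> would cost a
    factor of \<open>nv G\<close>.\<close>
  have "(1 + 2 * ne G + 3 * nv G) * ods_cost \<le> (6 * ne G) * ((6 * c + 4) * (k * nv G * ne G))"
    using nv_le_ne nv2 ods_cost_le by (intro mult_le_mono) linarith+
  also have "\<dots> = 36 * (c * N) + 24 * N" by (simp add: N_def power2_eq_square algebra_simps)
  finally have ods_cost: "(1 + 2 * ne G + 3 * nv G) * ods_cost \<le> 36 * (c * N) + 24 * N" .
  have "ne G \<le> ne G ^ 2" by (simp add: power2_eq_square)
  then have "1 + nv G \<le> 2 * N" using ne2_le nv_le_ne nv2 unfolding N_def by linarith
  then have "gap_after {} \<le> 4 * (c * N) + 6 * N + 2 * N" using opods_cost by (simp only: gap_after_def Diff_empty card_lessThan)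
  \<comment> \<open>The summands come from the initial search, from \<open>gap_after {}\<close> and
    from \<open>gap_before {}\<close>.\<close>
  then have "delay tr \<le> 2 * (c * N) + (4 * (c * N) + 6 * N + 2 * N) +
      (4 * (c * N) + 6 * N + (36 * (c * N) + 24 * N))"
    using algorithm4_delay[OF assms(1,2)] gap_before t' opods_cost ods_cost by linarith
  also have "\<dots> = (46 * c + 38) * N" by (simp add: algebra_simps)
  finally show ?thesis unfolding N_def .
qed

lemma amortized_time_le:
  assumes start: "correct_start G k (r, t)" "algorithm4 G S (r, t) tr"
    and t: "t \<le> c * (k ^ 3 * nv G ^ 3 + k * nv G ^ 2 * ne G)"
    and k2: "2 \<le> k" and ne: "kco \<noteq> {}"
  shows "amortized_time tr \<le> real ((56 * c + 38) * ne G ^ 2)"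
proof -
  define z where "z = ne G + 1 - nv G"
  define L where "L = length (outputs tr)"
  \<comment> \<open>Here \<open>k \<ge> 2\<close> enters; it makes \<open>z\<close> at least half
    the number of edges.\<close>
  have n2: "2 * nv G \<le> ne G" using kn_le mult_le_mono1[OF k2, of "nv G"] by linarith
  then have z: "1 \<le> z" "ne G \<le> 2 * z" using nv_le_ne by (auto simp: z_def)
  have card: "z \<le> card (outdeg_class D {})" if "D \<in> kco" for D
    using card_outdeg_class[OF that k1] nv2 by (simp add: z_def)
  have L: "z \<le> L" unfolding L_def by (rule algorithm4_total_time(2)[OF start ne card])
  have kn: "k * nv G \<le> 2 * z" using kn_le z(2) by linarith
  \<comment> \<open>The initial search is spread over the outputs: its factor
    \<open>k * nv G\<close> is at most twice the number \<open>L\<close> of outputs.\<close>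
  have "t \<le> c * (2 * (k * nv G * ne G ^ 2))"
    by (rule order_trans[OF t mult_le_mono2[OF start_steps_le[OF kn_le k1]]])
  also have "\<dots> \<le> c * (2 * (2 * z * ne G ^ 2))"
    by (rule mult_le_mono2[OF mult_le_mono2[OF mult_le_mono1[OF kn]]])
  also have "\<dots> \<le> c * (2 * (2 * L * ne G ^ 2))"
    by (rule mult_le_mono2[OF mult_le_mono2[OF mult_le_mono1[OF mult_le_mono2[OF L]]]])
  also have "\<dots> = 4 * c * ne G ^ 2 * L" by simp
  finally have "z * t \<le> z * (4 * c * ne G ^ 2 * L)" by (rule mult_le_mono2)
  then have "z * t \<le> z * (4 * c * ne G ^ 2) * L" by (simp only: mult.assoc)
  moreover have "ods_cost * (3 * nv G + 1) \<le> z * ((48 * c + 32) * ne G ^ 2)"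
  proof -
    have "ods_cost * (3 * nv G + 1) \<le> ((6 * c + 4) * (k * nv G * ne G)) * (4 * ne G)"
      using ods_cost_le nv_le_ne nv2 by (intro mult_le_mono) linarith+
    also have "\<dots> \<le> ((6 * c + 4) * (2 * z * ne G)) * (4 * ne G)"
      by (rule mult_le_mono1[OF mult_le_mono2[OF mult_le_mono1[OF kn]]])
    also have "\<dots> = z * ((48 * c + 32) * ne G ^ 2)" by (simp add: power2_eq_square algebra_simps)
    finally show ?thesis .
  qed
  moreover have "z * ((ne G + 1) * opods_cost) \<le> z * ((4 * c + 6) * ne G ^ 2)"
    by (rule mult_le_mono2[OF EnOPODS_cost_le])
  ultimately have "z * t + (z * ((ne G + 1) * opods_cost) + ods_cost * (3 * nv G + 1)) * L \<le>
      z * (4 * c * ne G ^ 2) * L + (z * ((4 * c + 6) * ne G ^ 2) + z * ((48 * c + 32) * ne G ^ 2)) * L"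
    by (intro add_mono mult_le_mono1)
  \<comment> \<open>\<open>4 * c\<close> stems from the initial search, \<open>4 * c + 6\<close>
    from \<open>EnOPODS\<close>, and \<open>48 * c + 32\<close> from the searches for flippable
    pairs.\<close>
  also have "\<dots> = z * ((56 * c + 38) * ne G ^ 2 * L)" by (simp add: algebra_simps)
  finally have "z * total_time tr \<le> z * ((56 * c + 38) * ne G ^ 2 * L)"
    using algorithm4_total_time(1)[OF start ne card] unfolding L_def by linarith
  then have "total_time tr \<le> (56 * c + 38) * ne G ^ 2 * L" using z(1) by simp
  then have "real (total_time tr) \<le> real ((56 * c + 38) * ne G ^ 2) * real L"
    by (metis of_nat_le_iff of_nat_mult)
  moreover have "0 < real L" using L z(1) by simp
  ultimately show ?thesis unfolding amortized_time_def L_def[symmetric] by (simp add: pos_divide_le_eq)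
qed

end

lemma (in multigraph) k_nv_le_ne:
  assumes "k_connected_orientations G k \<noteq> {}" "nv G \<ge> 2"
  shows "k * nv G \<le> ne G"
proof -
  obtain D where D: "D \<in> k_connected_orientations G k" using assms(1) by blast
  have "k * nv G = (\<Sum>v<nv G. k)" by simp
  also have "\<dots> \<le> (\<Sum>v<nv G. outdeg D v)"
    using k_le_outdeg[OF D assms(2)] by (intro sum_mono) simp
  finally show ?thesis using sum_outdeg_orientation[OF k_connected_orientation[OF D]] by simp
qed

lemma bounded_enumerationI:
  assumes "loopless_multigraph G" "correct_subroutines G k S" "subroutines_within c G k S"
    and "2 \<le> nv G" "1 \<le> k" "k_connected_orientations G k \<noteq> {} \<or> k * nv G \<le> ne G"
  shows "bounded_enumeration G k S c"
proof
  show "loopless_multigraph G" "correct_subroutines G k S" "2 \<le> nv G" "1 \<le> k" by fact+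
  interpret multigraph G by standard fact
  show "k * nv G \<le> ne G" using assms(4,6) k_nv_le_ne by blast
qed (use assms(3) in \<open>simp_all add: subroutines_within_def\<close>)

text \<open>The constant \<open>C\<close> depends only on the constant \<open>c\<close> of the
  subroutines, and some \<open>c\<close> fits the standard ones. For k = 0 the delay bound vanishes,
  and for a single vertex both bounds do, although a run takes time. If no orientation exists, only
  the initial search runs; its allowance may exceed the delay bound when \<open>ne G\<close> is
  below \<open>k * nv G\<close>, and there is no output to divide by.\<close>

theorem theorem5:
  shows
    "(\<forall>G k S I. loopless_multigraph G \<and> correct_subroutines G k S \<and> correct_start G k I \<longrightarrow>
        (\<exists>tr. algorithm4 G S I tr) \<and>
        (\<forall>tr. algorithm4 G S I tr \<longrightarrow>
           distinct (outputs tr) \<and> set (outputs tr) = k_connected_orientations G k))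
   \<and> (\<forall>c. \<exists>C. \<forall>G k S I tr.
        loopless_multigraph G \<and> nv G \<ge> 2 \<and> k \<ge> 1 \<and>
        correct_subroutines G k S \<and> subroutines_within c G k S \<and>
        correct_start G k I \<and> start_within c G k I \<and> algorithm4 G S I tr \<longrightarrow>
          (k_connected_orientations G k \<noteq> {} \<or> k * nv G \<le> ne G \<longrightarrow>
             delay tr \<le> C * (k * nv G * ne G ^ 2)) \<and>
          (k \<ge> 2 \<and> k_connected_orientations G k \<noteq> {} \<longrightarrow>
             amortized_time tr \<le> real (C * ne G ^ 2)))
   \<and> (\<exists>c. \<forall>G k. loopless_multigraph G \<longrightarrow>
        correct_subroutines G k (std_subroutines G k) \<and>
        subroutines_within c G k (std_subroutines G k))"
proof (intro conjI)
  show "\<forall>G k S I. loopless_multigraph G \<and> correct_subroutines G k S \<and> correct_start G k I \<longrightarrow>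
        (\<exists>tr. algorithm4 G S I tr) \<and>
        (\<forall>tr. algorithm4 G S I tr \<longrightarrow>
           distinct (outputs tr) \<and> set (outputs tr) = k_connected_orientations G k)"
  proof (intro allI impI)
    fix G k S I
    assume *: "loopless_multigraph G \<and> correct_subroutines G k S \<and> correct_start G k I"
    then interpret enumeration G k S by unfold_locales auto
    show "(\<exists>tr. algorithm4 G S I tr) \<and>
        (\<forall>tr. algorithm4 G S I tr \<longrightarrow>
           distinct (outputs tr) \<and> set (outputs tr) = k_connected_orientations G k)"
      using algorithm4_exists algorithm4_outputs * by blast
  qed
next
  show "\<forall>c. \<exists>C. \<forall>G k S I tr.
        loopless_multigraph G \<and> nv G \<ge> 2 \<and> k \<ge> 1 \<and>
        correct_subroutines G k S \<and> subroutines_within c G k S \<and>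
        correct_start G k I \<and> start_within c G k I \<and> algorithm4 G S I tr \<longrightarrow>
          (k_connected_orientations G k \<noteq> {} \<or> k * nv G \<le> ne G \<longrightarrow>
             delay tr \<le> C * (k * nv G * ne G ^ 2)) \<and>
          (k \<ge> 2 \<and> k_connected_orientations G k \<noteq> {} \<longrightarrow>
             amortized_time tr \<le> real (C * ne G ^ 2))"
  proof (rule allI, rule exI, intro allI impI)
    fix c k :: nat and G S I tr
    assume *: "loopless_multigraph G \<and> nv G \<ge> 2 \<and> k \<ge> 1 \<and>
        correct_subroutines G k S \<and> subroutines_within c G k S \<and>
        correct_start G k I \<and> start_within c G k I \<and> algorithm4 G S I tr"
    obtain r t where I: "I = (r, t)" by fastforce
    have start: "correct_start G k (r, t)" "algorithm4 G S (r, t) tr"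
      "t \<le> c * (k ^ 3 * nv G ^ 3 + k * nv G ^ 2 * ne G)"
      using * by (simp_all add: I start_within_def)
    have be: "bounded_enumeration G k S c" if "k_connected_orientations G k \<noteq> {} \<or> k * nv G \<le> ne G"
      using * that by (intro bounded_enumerationI) auto
    show "(k_connected_orientations G k \<noteq> {} \<or> k * nv G \<le> ne G \<longrightarrow>
             delay tr \<le> (56 * c + 38) * (k * nv G * ne G ^ 2)) \<and>
          (k \<ge> 2 \<and> k_connected_orientations G k \<noteq> {} \<longrightarrow>
             amortized_time tr \<le> real ((56 * c + 38) * ne G ^ 2))"
    proof (intro conjI impI)
      assume "k_connected_orientations G k \<noteq> {} \<or> k * nv G \<le> ne G"
      then have "delay tr \<le> (46 * c + 38) * (k * nv G * ne G ^ 2)"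
        by (rule bounded_enumeration.delay_le[OF be start])
      also have "\<dots> \<le> (56 * c + 38) * (k * nv G * ne G ^ 2)" by (intro mult_le_mono1) simp
      finally show "delay tr \<le> (56 * c + 38) * (k * nv G * ne G ^ 2)" .
    next
      assume k: "k \<ge> 2 \<and> k_connected_orientations G k \<noteq> {}"
      then show "amortized_time tr \<le> real ((56 * c + 38) * ne G ^ 2)"
        by (intro bounded_enumeration.amortized_time_le[OF be start]) auto
    qed
  qed
next
  show "\<exists>c. \<forall>G k. loopless_multigraph G \<longrightarrow>
        correct_subroutines G k (std_subroutines G k) \<and>
        subroutines_within c G k (std_subroutines G k)"
    using multigraph.std_subroutines_correct multigraph.intro by (intro exI[of _ 13]) blast
qed

end
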